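(* Let $d\ge 2$ and let $f:\mathbb{R}^d\to\mathbb{R}$ be a Gaussian field which is stationary, almost surely $C^2$-smooth, non-degenerate, and almost surely a Morse function. Let $$\kappa=\operatorname{div}\left(\frac{\nabla f}{|\nabla f|}\right).$$ Then for every $a\in\mathbb{R}$ (with $\kappa$, $f$ and $\nabla f$ evaluated at a common point $x$, the choice of which is immaterial by stationarity), $$\mathbb{E}[\kappa\mid f=a]=-a\,\mathbb{E}[|\nabla f|].$$
   Context: Gaussian fields are centred, with covariance kernel $K(x,y)=\mathbb{E}[f(x)f(y)]$. A field is stationary if $K$ is translation invariant; then $K$ is the Fourier transform of a finite symmetric Borel measure (the spectral measure), which is normalised to be a probability measure, so that $\operatorname{Var} f(x)=1$ for all $x$. A field $f$ is non-degenerate if the vector $(f,\nabla f)$ (at a point) has a density in $\mathbb{R}^{d+1}$. The function $\kappa$ is defined at points where $\nabla f\neq 0$, where it equals $(d-1)$ times the mean curvature of the level set of $f$ through that point. The conditional expectation given $f=a$ is the version continuous in $a$, given by Gaussian regression. *)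

theory Defs
  imports "HOL-Probability.Probability"
begin

subsection \<open>Differential operators and Morse functions on Euclidean space\<close>

definition gradient :: "(real^'n \<Rightarrow> real) \<Rightarrow> real^'n \<Rightarrow> real^'n" where
  "gradient g x = (THE D. GDERIV g x :> D)"

definition hessian :: "(real^'n \<Rightarrow> real) \<Rightarrow> real^'n \<Rightarrow> real^'n^'n" where
  "hessian g x = jacobian (gradient g) (at x)"

definition divergence :: "(real^'n \<Rightarrow> real^'n) \<Rightarrow> real^'n \<Rightarrow> real" where
  "divergence F x = trace (jacobian F (at x))"

definition C2_smooth :: "(real^'n \<Rightarrow> real) \<Rightarrow> bool" where
  "C2_smooth g \<longleftrightarrow>
     (\<forall>x. g differentiable (at x)) \<and>
     (\<forall>x. gradient g differentiable (at x)) \<and>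
     continuous_on UNIV (hessian g)"

definition morse_function :: "(real^'n \<Rightarrow> real) \<Rightarrow> bool" where
  "morse_function g \<longleftrightarrow>
     C2_smooth g \<and> (\<forall>x. gradient g x = 0 \<longrightarrow> det (hessian g x) \<noteq> 0)"

text \<open>Only the values at points where the gradient of \<open>g\<close> is nonzero are meaningful.\<close>

definition level_curvature :: "(real^'n \<Rightarrow> real) \<Rightarrow> real^'n \<Rightarrow> real" where
  "level_curvature g x = divergence (\<lambda>y. gradient g y /\<^sub>R norm (gradient g y)) x"

subsection \<open>Gaussian fields\<close>

text \<open>A field is a map \<open>f\<close> such that \<open>f \<omega>\<close> is the sample path and \<open>f \<omega> x\<close> its value at \<open>x\<close>.\<close>

text \<open>The degenerate law (point mass at 0) counts as a centred normal law.\<close>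

definition centred_normal :: "'w measure \<Rightarrow> ('w \<Rightarrow> real) \<Rightarrow> bool" where
  "centred_normal M X \<longleftrightarrow>
     X \<in> borel_measurable M \<and>
     ((AE \<omega> in M. X \<omega> = 0) \<or> (\<exists>\<sigma>>0. distributed M lborel X (normal_density 0 \<sigma>)))"

text \<open>All finite-dimensional distributions are centred Gaussian vectors, that is, all
  linear combinations of values of the field are centred normal.\<close>

definition gaussian_field :: "'w measure \<Rightarrow> ('w \<Rightarrow> real^'n \<Rightarrow> real) \<Rightarrow> bool" where
  "gaussian_field M f \<longleftrightarrow>
     (\<forall>S c. finite S \<longrightarrow> centred_normal M (\<lambda>\<omega>. \<Sum>x\<in>S. c x * f \<omega> x))"

definition covariance_kernel ::
    "'w measure \<Rightarrow> ('w \<Rightarrow> real^'n \<Rightarrow> real) \<Rightarrow> real^'n \<Rightarrow> real^'n \<Rightarrow> real" where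
  "covariance_kernel M f x y = (\<integral>\<omega>. f \<omega> x * f \<omega> y \<partial>M)"

text \<open>The second conjunct is the normalisation of the spectral measure: its total mass is the
  variance of the field at any point.\<close>

definition stationary_field :: "'w measure \<Rightarrow> ('w \<Rightarrow> real^'n \<Rightarrow> real) \<Rightarrow> bool" where
  "stationary_field M f \<longleftrightarrow>
     (\<forall>x y h. covariance_kernel M f (x + h) (y + h) = covariance_kernel M f x y) \<and>
     (\<forall>x. covariance_kernel M f x x = 1)"

text \<open>Sample paths are only almost surely differentiable, and on the exceptional null set
  \<^const>\<open>gradient\<close> takes unspecified values, so that random variables built from derivatives
  of the field need only be measurable with respect to the completion of the probability space.\<close>

definition nondegenerate_field :: "'w measure \<Rightarrow> ('w \<Rightarrow> real^'n \<Rightarrow> real) \<Rightarrow> bool" where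
  "nondegenerate_field M f \<longleftrightarrow>
     (\<forall>x. \<exists>p. distributed (completion M) lborel (\<lambda>\<omega>. (f \<omega> x, gradient (f \<omega>) x)) p)"

subsection \<open>Conditional expectation given the value of a random variable\<close>

text \<open>The function \<open>g\<close> is a continuous version of the regression function
  \<open>a \<mapsto> E[Y | X = a]\<close>. Integrability is required since \<^const>\<open>real_cond_exp\<close> is total.\<close>

definition continuous_regression ::
    "'w measure \<Rightarrow> ('w \<Rightarrow> real) \<Rightarrow> ('w \<Rightarrow> real) \<Rightarrow> (real \<Rightarrow> real) \<Rightarrow> bool" where
  "continuous_regression M Y X g \<longleftrightarrow>
     integrable M Y \<and> continuous_on UNIV g \<and>
     (AE \<omega> in M. real_cond_exp M (vimage_algebra (space M) X borel) Y \<omega> = g (X \<omega>))"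

definition cond_exp_at ::
    "'w measure \<Rightarrow> ('w \<Rightarrow> real) \<Rightarrow> ('w \<Rightarrow> real) \<Rightarrow> real \<Rightarrow> real" where
  "cond_exp_at M Y X a = (THE g. continuous_regression M Y X g) a"

end

theory Submission
  imports Defs
begin

text \<open>
  At a fixed point \<open>x\<close> the value \<open>X\<close>, the gradient \<open>V\<close> and the Hessian \<open>H\<close> of the field are jointly Gaussian,
  being iterated almost sure limits of linear combinations of field values. By stationarity the covariance
  kernel is invariant under the reflection in \<open>x\<close>, so derivatives of odd order are uncorrelated with
  derivatives of even order: \<open>V\<close> is uncorrelated with \<open>X\<close> and with \<open>H\<close>. Differentiating the identity
  \<open>E[f \<cdot> \<partial>\<^sub>i f] = 0\<close> gives \<open>E[H\<^sub>i\<^sub>j X] = - L\<^sub>i\<^sub>j\<close>, where \<open>L\<close> is the covariance matrix of \<open>V\<close>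
  (\<open>expectation_field_gradient\<close>, \<open>expectation_hessian_gradient\<close>, \<open>expectation_hessian_field\<close>).
  As \<open>X\<close> has variance one, \<open>H = - X L + R\<close> with a centred \<open>R\<close> whose entries are independent of \<open>(X, V)\<close>, and \<open>X\<close> is
  independent of \<open>V\<close>.

  By the chain rule \<open>\<kappa> = tr (J(V) H)\<close>, where \<open>J(v)\<close> is the Jacobian matrix of \<open>v \<mapsto> v / norm v\<close>
  (\<open>level_curvature_eq\<close>). Therefore \<open>E[\<kappa> | X = a] = - a E[tr (J(V) L)]\<close>, and Gaussian integration by parts
  turns \<open>E[tr (J(V) L)]\<close> into \<open>E[V \<bullet> (V / norm V)] = E[norm V]\<close> (\<open>expectation_norm_gaussian\<close>). The field
  \<open>v / norm v\<close> is singular at the origin; a regularisation of it can be removed because \<open>1 / norm V\<close> is integrable,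
  which holds for nondegenerate \<open>V\<close> in dimension at least two (\<open>integrable_inverse_norm_gaussian\<close>).

  Joint Gaussianity is handled through vector spaces of centred normal variables. Such a space
  stays one after adding almost sure limits, with convergence of covariances
  (\<open>gaussian_space_ae_limits\<close>, \<open>covariance_tendsto\<close>), and uncorrelated members are independent by uniqueness of
  multivariate characteristic functions (\<open>uncorrelated_imp_joint_law_eq_product\<close>).
\<close>

section \<open>Uniqueness of multivariate characteristic functions\<close>

lemma borel_measurable_cis [measurable]: "cis \<in> borel_measurable borel"
  by (intro borel_measurable_continuous_onI) (simp add: cis_conv_exp continuous_intros)

text \<open>Normalisation reduces this to Levy's uniqueness theorem for probability measures. Finite measures
  are needed because the induction below works with laws weighted by a density.\<close>

lemma finite_measure_eq_if_char_eq:
  fixes M N :: "real measure"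
  assumes M: "finite_measure M" and N: "finite_measure N"
    and [measurable_cong]: "sets M = sets borel" "sets N = sets borel"
    and char: "\<And>t. (\<integral>x. cis (t * x) \<partial>M) = (\<integral>x. cis (t * x) \<partial>N)"
  shows "M = N"
proof -
  interpret M: finite_measure M by fact
  interpret N: finite_measure N by fact
  have sp: "space M = UNIV" "space N = UNIV"
    using assms(3,4)[THEN sets_eq_imp_space_eq] by simp_all
  define c where "c = measure M UNIV"
  have c: "measure N UNIV = c"
    using char[of 0] by (simp add: c_def sp)
  show ?thesis
  proof (cases "c = 0")
    case True
    have "emeasure M A = emeasure N A" if "A \<in> sets M" for A
    proof -
      have "measure M A \<le> 0" "measure N A \<le> 0"
        using M.bounded_measure[of A] N.bounded_measure[of A] True c by (simp_all add: c_def sp)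
      then show ?thesis
        by (simp add: M.emeasure_eq_measure N.emeasure_eq_measure measure_le_0_iff)
    qed
    then show ?thesis
      using assms(3,4) by (intro measure_eqI) auto
  next
    case False
    then have cpos: "c > 0"
      by (simp add: c_def zero_less_measure_iff)
    have rd: "real_distribution (density K (\<lambda>_. ennreal (1/c)))"
      if K: "finite_measure K" "sets K = sets borel" "measure K UNIV = c" for K :: "real measure"
    proof -
      interpret K: finite_measure K by fact
      have spK: "space K = UNIV" using K(2) sets_eq_imp_space_eq by fastforce
      have "emeasure (density K (\<lambda>_. ennreal (1/c))) UNIV = 1"
        using cpos K by (subst emeasure_density)
          (auto simp: spK K.emeasure_eq_measure simp flip: ennreal_mult')
      then show ?thesis
        using K spK by (auto simp: real_distribution_def real_distribution_axioms_def intro!: prob_spaceI)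
    qed
    have chd: "char (density K (\<lambda>_. ennreal (1/c))) t = (\<integral>x. cis (t * x) \<partial>K) / c"
      if K[measurable_cong]: "sets K = sets borel" for K t
      using cpos unfolding char_def
      by (subst integral_density) (auto simp: cis_conv_exp scaleR_conv_of_real mult_ac)
    have eq: "density M (\<lambda>_. ennreal (1/c)) = density N (\<lambda>_. ennreal (1/c))"
      using rd[OF M assms(3)] rd[OF N assms(4) c] chd[OF assms(3)] chd[OF assms(4)] char
      by (intro Levy_uniqueness) (auto simp: c_def)
    have undo: "density (density K (\<lambda>_. ennreal (1/c))) (\<lambda>_. ennreal c) = K"
      if "sets K = sets borel" for K :: "real measure"
      using cpos by (subst density_density_eq) (auto simp: density_1 simp flip: ennreal_mult')
    show ?thesis
      using undo[OF assms(3)] undo[OF assms(4)] eq by metis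
  qed
qed

text \<open>The multivariate uniqueness theorem is reduced to the one-dimensional one by adding one coordinate
  constraint at a time. Restrict both measures to the constraints in \<open>S\<close>, weight them with
  \<open>1 + Re (u * cis (v \<bullet> x))\<close>, and project them to the coordinate \<open>b\<close>. The weight is nonnegative for
  \<open>norm u \<le> 1\<close>, so this gives finite measures on the line; since the weight is a combination of
  \<open>1\<close>, \<open>cis (v \<bullet> x)\<close> and \<open>cis (- v \<bullet> x)\<close>, the induction hypothesis shows that their characteristic
  functions agree.\<close>

lemma char_eq_on_rectangles:
  fixes M N :: "'b::euclidean_space measure"
  assumes M: "finite_measure M" and N: "finite_measure N"
    and sets: "sets M = sets borel" "sets N = sets borel"
    and char: "\<And>v. (\<integral>x. cis (v \<bullet> x) \<partial>M) = (\<integral>x. cis (v \<bullet> x) \<partial>N)"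
    and "finite S" and B: "\<And>b. B b \<in> sets borel"
  shows "(\<integral>x. indicator {x. \<forall>b\<in>S. x \<bullet> b \<in> B b} x *\<^sub>R cis (v \<bullet> x) \<partial>M) =
         (\<integral>x. indicator {x. \<forall>b\<in>S. x \<bullet> b \<in> B b} x *\<^sub>R cis (v \<bullet> x) \<partial>N)"
  using \<open>finite S\<close>
proof (induction S arbitrary: v rule: finite_induct)
  case empty
  then show ?case using char by simp
next
  case (insert b S)
  define R where "R = {x::'b. \<forall>b\<in>S. x \<bullet> b \<in> B b}"
  define R' where "R' = {x::'b. \<forall>b\<in>insert b S. x \<bullet> b \<in> B b}"
  note B[measurable]
  have [measurable]: "R \<in> sets borel" "R' \<in> sets borel"
    using insert(1) by (auto simp: R_def R'_def)
  define w where "w u x = 1 + Re (u * cis (v \<bullet> x))" for u x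
  have Re_le: "\<bar>Re (u * cis y)\<bar> \<le> 1" if "norm u \<le> 1" for u y
    using abs_Re_le_cmod[of "u * cis y"] that by (simp add: norm_mult)
  have w0: "0 \<le> w u x" "w u x \<le> 2" if "norm u \<le> 1" for u x
    using Re_le[OF that, of "v \<bullet> x"] unfolding w_def by linarith+
  have [measurable]: "w u \<in> borel_measurable borel" for u
    unfolding w_def by measurable
  define P where "P K u = distr (density K (\<lambda>x. ennreal (indicator R x * w u x))) borel (\<lambda>x. x \<bullet> b)"
    for K :: "'b measure" and u
  have finK: "finite_measure (P K u)"
    and chK: "(\<integral>y. cis (t * y) \<partial>(P K u)) =
        (\<integral>x. indicator R x *\<^sub>R cis ((t *\<^sub>R b) \<bullet> x) \<partial>K)
        + u/2 * (\<integral>x. indicator R x *\<^sub>R cis ((v + t *\<^sub>R b) \<bullet> x) \<partial>K)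
        + cnj u/2 * (\<integral>x. indicator R x *\<^sub>R cis ((- v + t *\<^sub>R b) \<bullet> x) \<partial>K)"
    and meK: "measure (P K u) (B b) = (\<integral>x. indicator R' x * w u x \<partial>K)"
    and inK: "integrable K (\<lambda>x. indicator R' x *\<^sub>R (u * cis (v \<bullet> x)))"
    if K: "finite_measure K" and sK[measurable_cong]: "sets K = sets borel" and u: "norm u \<le> 1"
    for K u t
  proof -
    interpret K: finite_measure K by fact
    have int: "integrable K (\<lambda>x. indicator A x * w u x)" if [measurable]: "A \<in> sets borel" for A
      by (rule K.integrable_const_bound[where B=2])
         (auto simp: indicator_def w0[OF u])
    have intc: "integrable K (\<lambda>x. indicator A x *\<^sub>R cis (y \<bullet> x))" if [measurable]: "A \<in> sets borel" for y A
      by (rule K.integrable_const_bound[where B=1]) (auto simp: indicator_def)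
    show "finite_measure (P K u)"
    proof
      have "emeasure (P K u) (space (P K u)) = (\<integral>\<^sup>+x. ennreal (indicator R x * w u x) \<partial>K)"
        by (simp add: P_def emeasure_distr emeasure_density sets_eq_imp_space_eq[OF sK])
      also have "\<dots> < \<infinity>"
        using int[of R] by (subst nn_integral_eq_integral) (auto simp: w0[OF u])
      finally show "emeasure (P K u) (space (P K u)) \<noteq> \<infinity>" by simp
    qed
    have pt: "(indicator R x * w u x) *\<^sub>R cis (t * (x \<bullet> b)) =
        indicator R x *\<^sub>R cis ((t *\<^sub>R b) \<bullet> x)
        + u/2 * (indicator R x *\<^sub>R cis ((v + t *\<^sub>R b) \<bullet> x))
        + cnj u/2 * (indicator R x *\<^sub>R cis ((- v + t *\<^sub>R b) \<bullet> x))" for x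
    proof -
      have "complex_of_real (w u x) = 1 + (u * cis (v \<bullet> x) + cnj u * cis (- (v \<bullet> x)))/2"
        unfolding w_def by (simp add: complex_eq_iff cis.ctr)
      moreover have "cis ((v + t *\<^sub>R b) \<bullet> x) = cis (v \<bullet> x) * cis ((t *\<^sub>R b) \<bullet> x)"
        "cis ((- v + t *\<^sub>R b) \<bullet> x) = cis (- (v \<bullet> x)) * cis ((t *\<^sub>R b) \<bullet> x)"
        by (simp_all add: cis_mult inner_add_left inner_diff_left)
      moreover have "t * (x \<bullet> b) = (t *\<^sub>R b) \<bullet> x" by (simp add: inner_commute)
      ultimately show ?thesis
        by (simp only: scaleR_conv_of_real of_real_mult) (simp add: field_simps)
    qed
    have "(\<integral>y. cis (t * y) \<partial>(P K u)) = (\<integral>x. (indicator R x * w u x) *\<^sub>R cis (t * (x \<bullet> b)) \<partial>K)"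
      unfolding P_def by (simp add: integral_distr integral_density w0[OF u])
    also have "\<dots> = (\<integral>x. indicator R x *\<^sub>R cis ((t *\<^sub>R b) \<bullet> x) \<partial>K)
        + u/2 * (\<integral>x. indicator R x *\<^sub>R cis ((v + t *\<^sub>R b) \<bullet> x) \<partial>K)
        + cnj u/2 * (\<integral>x. indicator R x *\<^sub>R cis ((- v + t *\<^sub>R b) \<bullet> x) \<partial>K)"
    proof -
      have *: "(\<integral>x. p x + c * q x + d * r x \<partial>K) =
          (\<integral>x. p x \<partial>K) + c * (\<integral>x. q x \<partial>K) + d * (\<integral>x. r x \<partial>K)"
        if "integrable K p" "integrable K q" "integrable K r" for p q r :: "'b \<Rightarrow> complex" and c d
        using that by simp
      show ?thesis
        unfolding pt by (rule *) (rule intc; measurable)+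
    qed
    finally show "(\<integral>y. cis (t * y) \<partial>(P K u)) = \<dots>" .
    have Bb [measurable]: "(\<lambda>x. x \<bullet> b) -` B b \<in> sets borel"
      by (rule measurable_sets_borel[OF _ B]) measurable
    have "emeasure (P K u) (B b) = (\<integral>\<^sup>+x. ennreal (indicator R x * w u x) * indicator ((\<lambda>x. x \<bullet> b) -` B b) x \<partial>K)"
      by (simp add: P_def emeasure_distr emeasure_density sets_eq_imp_space_eq[OF sK] sK)
    also have "\<dots> = (\<integral>\<^sup>+x. ennreal (indicator R' x * w u x) \<partial>K)"
      by (intro nn_integral_cong) (auto simp: indicator_def R_def R'_def)
    also have "\<dots> = ennreal (\<integral>x. indicator R' x * w u x \<partial>K)"
      using int[of R'] by (subst nn_integral_eq_integral) (auto simp: w0[OF u])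
    finally show "measure (P K u) (B b) = (\<integral>x. indicator R' x * w u x \<partial>K)"
      by (simp add: measure_def integral_nonneg_AE w0[OF u])
    show "integrable K (\<lambda>x. indicator R' x *\<^sub>R (u * cis (v \<bullet> x)))"
      using integrable_mult_right[OF intc[of R' v], of u] by simp
  qed
  have eqw: "(\<integral>x. indicator R' x * w u x \<partial>M) = (\<integral>x. indicator R' x * w u x \<partial>N)" if u: "norm u \<le> 1" for u
  proof -
    have "P M u = P N u"
    proof (rule finite_measure_eq_if_char_eq)
      show "finite_measure (P M u)" "finite_measure (P N u)"
        using finK[OF M sets(1) u] finK[OF N sets(2) u] by auto
      show "sets (P M u) = sets borel" "sets (P N u) = sets borel"
        by (simp_all add: P_def)
      show "(\<integral>y. cis (t * y) \<partial>P M u) = (\<integral>y. cis (t * y) \<partial>P N u)" for t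
        unfolding chK[OF M sets(1) u] chK[OF N sets(2) u] insert.IH[folded R_def] ..
    qed
    then show ?thesis
      using meK[OF M sets(1) u] meK[OF N sets(2) u] by simp
  qed
  have split: "Re (u * (\<integral>x. indicator R' x *\<^sub>R cis (v \<bullet> x) \<partial>K)) =
      (\<integral>x. indicator R' x * w u x \<partial>K) - (\<integral>x. indicator R' x * w 0 x \<partial>K)"
    if K: "finite_measure K" and sK[measurable_cong]: "sets K = sets borel" and u: "norm u \<le> 1" for K u
  proof -
    interpret K: finite_measure K by fact
    have int: "integrable K (\<lambda>x. indicator R' x * w u x)" if "norm u \<le> 1" for u
      by (rule K.integrable_const_bound[where B=2])
         (auto simp: indicator_def w0[OF that])
    have "Re (u * (\<integral>x. indicator R' x *\<^sub>R cis (v \<bullet> x) \<partial>K)) =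
       Re (\<integral>x. indicator R' x *\<^sub>R (u * cis (v \<bullet> x)) \<partial>K)"
      by (simp flip: integral_mult_right_zero)
    also have "\<dots> = (\<integral>x. Re (indicator R' x *\<^sub>R (u * cis (v \<bullet> x))) \<partial>K)"
      by (rule integral_Re[symmetric]) (rule inK[OF K sK u])
    also have "\<dots> = (\<integral>x. indicator R' x * w u x - indicator R' x * w 0 x \<partial>K)"
      by (intro Bochner_Integration.integral_cong) (auto simp: w_def algebra_simps)
    also have "\<dots> = (\<integral>x. indicator R' x * w u x \<partial>K) - (\<integral>x. indicator R' x * w 0 x \<partial>K)"
      using int u by (intro Bochner_Integration.integral_diff) auto
    finally show ?thesis .
  qed
  \<comment> \<open>The choices \<open>u = 1\<close> and \<open>u = - \<i>\<close> recover the real and the imaginary part of the integral.\<close>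
  have key: "Re (u * (\<integral>x. indicator R' x *\<^sub>R cis (v \<bullet> x) \<partial>M)) =
             Re (u * (\<integral>x. indicator R' x *\<^sub>R cis (v \<bullet> x) \<partial>N))" if "norm u \<le> 1" for u
    using split[OF M sets(1) that] split[OF N sets(2) that] eqw[OF that] eqw[of 0] by simp
  show ?case
    unfolding R'_def[symmetric] using key[of 1] key[of "-\<i>"] by (simp add: complex_eq_iff)
qed

lemma measure_eq_if_char_eq:
  fixes M N :: "'b::euclidean_space measure"
  assumes M: "prob_space M" and N: "prob_space N"
    and sets: "sets M = sets borel" "sets N = sets borel"
    and char: "\<And>v. (\<integral>x. cis (v \<bullet> x) \<partial>M) = (\<integral>x. cis (v \<bullet> x) \<partial>N)"
  shows "M = N"
proof -
  interpret M: prob_space M by fact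
  interpret N: prob_space N by fact
  have sp: "space M = UNIV" "space N = UNIV"
    using sets[THEN sets_eq_imp_space_eq] by simp_all
  have box: "emeasure M (box l u) = emeasure N (box l u)" for l u
  proof -
    have R: "{x. \<forall>b\<in>Basis. x \<bullet> b \<in> {l \<bullet> b<..<u \<bullet> b}} = box l u"
      by (auto simp: box_def)
    have I: "(\<integral>x. indicator (box l u) x *\<^sub>R cis (0 \<bullet> x) \<partial>K) = complex_of_real (measure K (box l u))"
      if "sets K = sets borel" "space K = UNIV" for K
      by (simp add: scaleR_conv_of_real that)
    have "complex_of_real (measure M (box l u)) = complex_of_real (measure N (box l u))"
      using char_eq_on_rectangles[OF M.finite_measure_axioms N.finite_measure_axioms sets char
          finite_Basis, of "\<lambda>b. {l \<bullet> b<..<u \<bullet> b}" 0]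
      unfolding R I[OF sets(1) sp(1)] I[OF sets(2) sp(2)] by simp
    then have "measure M (box l u) = measure N (box l u)"
      by (simp only: of_real_eq_iff)
    then show ?thesis
      by (simp add: M.emeasure_eq_measure N.emeasure_eq_measure)
  qed
  show ?thesis
  proof (rule measure_eqI_generator_eq)
    let ?E = "range (\<lambda>(l, u). box l u::'b set)"
    show "Int_stable ?E"
      by (auto simp: Int_stable_def box_Int_box)
    show "?E \<subseteq> Pow UNIV" by simp
    show "emeasure M X = emeasure N X" if "X \<in> ?E" for X
      using that box by auto
    show "sets M = sigma_sets UNIV ?E" "sets N = sigma_sets UNIV ?E"
      by (simp_all add: sets borel_eq_box)
    show "range (\<lambda>n::nat. box (- real n *\<^sub>R One) (real n *\<^sub>R One)) \<subseteq> ?E" 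
      by auto
    show "(\<Union>n::nat. box (- real n *\<^sub>R One) (real n *\<^sub>R One)) = (UNIV::'b set)"
      using UN_box_eq_UNIV by simp
    show "emeasure M (box (- real n *\<^sub>R One) (real n *\<^sub>R One)) \<noteq> \<infinity>" for n
      by simp
  qed
qed

text \<open>Independence is stated as equality of the joint law with the product law, since the two variables
  take values in different types.\<close>

lemma (in prob_space) joint_law_eq_product_if_char_factors:
  fixes Z :: "'a \<Rightarrow> real" and V :: "'a \<Rightarrow> 'b::euclidean_space"
  assumes [measurable]: "Z \<in> borel_measurable M" "V \<in> borel_measurable M"
    and char: "\<And>t v. expectation (\<lambda>\<omega>. cis (t * Z \<omega> + v \<bullet> V \<omega>)) =
      expectation (\<lambda>\<omega>. cis (t * Z \<omega>)) * expectation (\<lambda>\<omega>. cis (v \<bullet> V \<omega>))"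
  shows "distr M borel Z \<Otimes>\<^sub>M distr M borel V = distr M borel (\<lambda>\<omega>. (Z \<omega>, V \<omega>))"
proof -
  interpret Z: prob_space "distr M borel Z" by (rule prob_space_distr) simp
  interpret V: prob_space "distr M borel V" by (rule prob_space_distr) simp
  interpret ZV: pair_prob_space "distr M borel Z" "distr M borel V" ..
  show "distr M borel Z \<Otimes>\<^sub>M distr M borel V = distr M borel (\<lambda>\<omega>. (Z \<omega>, V \<omega>))"
  proof (rule measure_eq_if_char_eq)
    show "prob_space (distr M borel Z \<Otimes>\<^sub>M distr M borel V)"
      by (rule ZV.prob_space_axioms)
    show "prob_space (distr M borel (\<lambda>\<omega>. (Z \<omega>, V \<omega>)))"
      by (rule prob_space_distr) simp
    show s: "sets (distr M borel Z \<Otimes>\<^sub>M distr M borel V) = sets borel"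
      by (subst borel_prod[symmetric]) (intro sets_pair_measure_cong; simp)
    show "sets (distr M borel (\<lambda>\<omega>. (Z \<omega>, V \<omega>))) = sets borel" by simp
    fix p :: "real \<times> 'b"
    obtain t v where p: "p = (t, v)" by (cases p)
    have "(\<integral>x. cis (p \<bullet> x) \<partial>(distr M borel Z \<Otimes>\<^sub>M distr M borel V)) =
      (\<integral>x. (\<integral>y. cis (p \<bullet> (x, y)) \<partial>distr M borel V) \<partial>distr M borel Z)"
      by (rule ZV.integral_fst'[symmetric], rule ZV.integrable_const_bound[where B=1])
         (auto simp: measurable_cong_sets[OF s refl])
    also have "\<dots> = (\<integral>x. cis (t * x) \<partial>distr M borel Z) * (\<integral>y. cis (v \<bullet> y) \<partial>distr M borel V)"
      by (simp add: p cis_mult[symmetric])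
    also have "\<dots> = (\<integral>x. cis (p \<bullet> x) \<partial>distr M borel (\<lambda>\<omega>. (Z \<omega>, V \<omega>)))"
      using char[of t v] by (simp add: integral_distr p)
    finally show "(\<integral>x. cis (p \<bullet> x) \<partial>(distr M borel Z \<Otimes>\<^sub>M distr M borel V)) = \<dots>" .
  qed
qed

lemma (in prob_space) indep_var_compose_if_joint_law_eq_product:
  fixes Z :: "'a \<Rightarrow> real" and V :: "'a \<Rightarrow> 'b::euclidean_space" and h k :: "_ \<Rightarrow> real"
  assumes [measurable]: "Z \<in> borel_measurable M" "V \<in> borel_measurable M"
      "h \<in> borel_measurable borel" "k \<in> borel_measurable borel"
    and eq: "distr M borel Z \<Otimes>\<^sub>M distr M borel V = distr M borel (\<lambda>\<omega>. (Z \<omega>, V \<omega>))"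
  shows "indep_var borel (\<lambda>\<omega>. h (Z \<omega>)) borel (\<lambda>\<omega>. k (V \<omega>))"
proof -
  interpret V: prob_space "distr M borel V" by (rule prob_space_distr) simp
  have k: "prob_space (distr (distr M borel V) borel k)" by (rule V.prob_space_distr) simp
  have "distr M borel (\<lambda>\<omega>. h (Z \<omega>)) \<Otimes>\<^sub>M distr M borel (\<lambda>\<omega>. k (V \<omega>)) =
      distr (distr M borel Z) borel h \<Otimes>\<^sub>M distr (distr M borel V) borel k"
    by (simp add: distr_distr o_def)
  also have "\<dots> = distr (distr M borel Z \<Otimes>\<^sub>M distr M borel V) (borel \<Otimes>\<^sub>M borel) (\<lambda>(x, y). (h x, k y))"
    using k by (intro pair_measure_distr) (auto simp: prob_space_imp_sigma_finite)
  also have "\<dots> = distr M (borel \<Otimes>\<^sub>M borel) (\<lambda>\<omega>. (h (Z \<omega>), k (V \<omega>)))"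
    unfolding eq by (subst distr_distr) (auto simp: o_def borel_prod[symmetric])
  finally show ?thesis
    by (auto simp: indep_var_distribution_eq)
qed

section \<open>Centred normal variables and Gaussian spaces\<close>

context prob_space begin

lemma
  assumes "centred_normal M X"
  shows centred_normal_integrable: "integrable M X"
    and centred_normal_integrable_square: "integrable M (\<lambda>\<omega>. (X \<omega>)\<^sup>2)"
    and centred_normal_expectation: "expectation X = 0"
    and centred_normal_char: "expectation (\<lambda>\<omega>. cis (t * X \<omega>)) = exp (- t\<^sup>2 * expectation (\<lambda>\<omega>. (X \<omega>)\<^sup>2) / 2)"
proof -
  have [measurable]: "X \<in> borel_measurable M" using assms by (simp add: centred_normal_def)
  have "integrable M X \<and> integrable M (\<lambda>\<omega>. (X \<omega>)\<^sup>2) \<and> expectation X = 0 \<and>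
     expectation (\<lambda>\<omega>. cis (t * X \<omega>)) = exp (- t\<^sup>2 * expectation (\<lambda>\<omega>. (X \<omega>)\<^sup>2) / 2)"
  proof (cases "AE \<omega> in M. X \<omega> = 0")
    case True
    have "integrable M X = integrable M (\<lambda>_. 0::real)"
      using True by (intro integrable_cong_AE) auto
    moreover have "integrable M (\<lambda>\<omega>. (X \<omega>)\<^sup>2) = integrable M (\<lambda>_. 0::real)"
      using True by (intro integrable_cong_AE) auto
    moreover have "expectation X = expectation (\<lambda>_. 0)"
      using True by (intro integral_cong_AE) auto
    moreover have "expectation (\<lambda>\<omega>. (X \<omega>)\<^sup>2) = expectation (\<lambda>_. 0)"
      using True by (intro integral_cong_AE) auto
    moreover have "expectation (\<lambda>\<omega>. cis (t * X \<omega>)) = expectation (\<lambda>_. 1)"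
      using True by (intro integral_cong_AE) auto
    ultimately show ?thesis by (simp add: prob_space)
  next
    case False
    then obtain \<sigma> where \<sigma>: "\<sigma> > 0" and X: "distributed M lborel X (normal_density 0 \<sigma>)"
      using assms by (auto simp: centred_normal_def)
    have 1: "integrable M X"
      using distributed_integrable[OF X, of "\<lambda>x. x"] integrable_normal_moment_nz_1[OF \<sigma>, of 0] by simp
    have 2: "integrable M (\<lambda>\<omega>. (X \<omega>)\<^sup>2)"
      using distributed_integrable[OF X, of "\<lambda>x. x\<^sup>2"] integrable_normal_moment[OF \<sigma>, of 0 2] by simp
    have 3: "expectation X = 0"
      using normal_distributed_expectation[OF \<sigma> X] .
    have 4: "expectation (\<lambda>\<omega>. (X \<omega>)\<^sup>2) = \<sigma>\<^sup>2"
      using normal_distributed_variance[OF \<sigma> X] 3 by simp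
    have std: "distributed M lborel (\<lambda>\<omega>. X \<omega> / \<sigma>) std_normal_density"
      using normal_standard_normal_convert[OF \<sigma>, of X 0] X by simp
    have "expectation (\<lambda>\<omega>. cis (t * X \<omega>)) = expectation (\<lambda>\<omega>. cis (t * \<sigma> * (X \<omega> / \<sigma>)))"
      using \<sigma> by simp
    also have "\<dots> = char (distr M lborel (\<lambda>\<omega>. X \<omega> / \<sigma>)) (t * \<sigma>)"
      unfolding char_def by (subst integral_distr) (auto simp: cis_conv_exp mult_ac)
    also have "\<dots> = exp (- (t * \<sigma>)\<^sup>2 / 2)"
      unfolding distributed_distr_eq_density[OF std] by (simp add: char_std_normal_distribution)
    finally show ?thesis
      using 1 2 3 4 by (simp add: power_mult_distrib)
  qed
  then show "integrable M X" "integrable M (\<lambda>\<omega>. (X \<omega>)\<^sup>2)" "expectation X = 0"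
     "expectation (\<lambda>\<omega>. cis (t * X \<omega>)) = exp (- t\<^sup>2 * expectation (\<lambda>\<omega>. (X \<omega>)\<^sup>2) / 2)"
    by auto
qed

text \<open>By uniqueness of characteristic functions: for \<open>s = 0\<close> the law is the point mass at the origin,
  otherwise \<open>X / sqrt s\<close> is standard normal.\<close>

lemma centred_normal_if_char:
  assumes [measurable]: "X \<in> borel_measurable M" and "s \<ge> 0"
    and char: "\<And>t. expectation (\<lambda>\<omega>. cis (t * X \<omega>)) = complex_of_real (exp (- t\<^sup>2 * s / 2))"
  shows "centred_normal M X \<and> expectation (\<lambda>\<omega>. (X \<omega>)\<^sup>2) = s"
proof (cases "s = 0")
  case True
  have "distr M borel X = return borel 0"
  proof (rule finite_measure_eq_if_char_eq)
    show "finite_measure (distr M borel X)" 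
      by (rule prob_space.finite_measure, rule prob_space_distr) simp
    show "finite_measure (return borel (0::real))"
      by (rule prob_space.finite_measure, rule prob_space_return) simp
    show "(\<integral>x. cis (t * x) \<partial>distr M borel X) = (\<integral>x. cis (t * x) \<partial>return borel 0)" for t
      using char[of t] True by (simp add: integral_distr integral_return)
  qed auto
  moreover have "AE x in return borel (0::real). x = 0"
    by (subst AE_return) auto
  ultimately have "AE x in distr M borel X. x = 0" by (simp only:)
  then have 0: "AE \<omega> in M. X \<omega> = 0"
    by (subst (asm) AE_distr_iff) auto
  then have "expectation (\<lambda>\<omega>. (X \<omega>)\<^sup>2) = expectation (\<lambda>_. 0)"
    by (intro integral_cong_AE) auto
  with 0 True show ?thesis by (simp add: centred_normal_def)
next
  case False
  define \<sigma> where "\<sigma> = sqrt s"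
  have \<sigma>: "\<sigma> > 0" "\<sigma>\<^sup>2 = s" using False \<open>s \<ge> 0\<close> by (simp_all add: \<sigma>_def)
  have "distr M borel (\<lambda>\<omega>. X \<omega> / \<sigma>) = std_normal_distribution"
  proof (rule finite_measure_eq_if_char_eq)
    show "finite_measure (distr M borel (\<lambda>\<omega>. X \<omega> / \<sigma>))" 
      by (rule prob_space.finite_measure, rule prob_space_distr) simp
    show "finite_measure std_normal_distribution"
      by (rule prob_space.finite_measure, rule prob_space_normal_density) simp
    show "(\<integral>x. cis (t * x) \<partial>distr M borel (\<lambda>\<omega>. X \<omega> / \<sigma>)) = (\<integral>x. cis (t * x) \<partial>std_normal_distribution)" for t
      using char[of "t/\<sigma>"] fun_cong[OF char_std_normal_distribution, of t] \<sigma> False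
      unfolding char_def
      by (simp add: integral_distr cis_conv_exp power_divide)
  qed auto
  then have "distributed M lborel (\<lambda>\<omega>. X \<omega> / \<sigma>) std_normal_density"
    unfolding distributed_def using distr_cong[OF refl sets_lborel refl, of M "\<lambda>\<omega>. X \<omega> / \<sigma>"] by simp
  then have X: "distributed M lborel X (normal_density 0 \<sigma>)"
    using normal_standard_normal_convert[OF \<sigma>(1), of X 0] by simp
  then show ?thesis
    using normal_distributed_variance[OF \<sigma>(1) X] normal_distributed_expectation[OF \<sigma>(1) X] \<sigma>
    by (auto simp: centred_normal_def)
qed

text \<open>Almost sure convergence of centred normal variables forces convergence of the variances \<open>s n\<close>:
  the characteristic functions \<open>exp (- t\<^sup>2 * s n / 2)\<close> converge for every \<open>t\<close>, and at some \<open>t0 \<noteq> 0\<close> the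
  limit is not zero, so that the logarithm can be taken there.\<close>

lemma
  assumes X: "\<And>n::nat. centred_normal M (X n)" and [measurable]: "Y \<in> borel_measurable M"
    and lim: "AE \<omega> in M. (\<lambda>n. X n \<omega>) \<longlonglongrightarrow> Y \<omega>"
  shows centred_normal_limit: "centred_normal M Y"
    and centred_normal_limit_variance: "(\<lambda>n. expectation (\<lambda>\<omega>. (X n \<omega>)\<^sup>2)) \<longlonglongrightarrow> expectation (\<lambda>\<omega>. (Y \<omega>)\<^sup>2)"
proof -
  have [measurable]: "X n \<in> borel_measurable M" for n
    using X by (simp add: centred_normal_def)
  define s where "s n = expectation (\<lambda>\<omega>. (X n \<omega>)\<^sup>2)" for n
  define \<phi> where "\<phi> t = expectation (\<lambda>\<omega>. cis (t * Y \<omega>))" for t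
  have s0: "s n \<ge> 0" for n unfolding s_def by (rule Bochner_Integration.integral_nonneg) simp
  have conv: "(\<lambda>n. complex_of_real (exp (- t\<^sup>2 * s n / 2))) \<longlonglongrightarrow> \<phi> t" for t
    unfolding s_def centred_normal_char[OF X, symmetric] \<phi>_def
  proof (rule integral_dominated_convergence[where w="\<lambda>_. 1"])
    show "AE \<omega> in M. (\<lambda>n. cis (t * X n \<omega>)) \<longlonglongrightarrow> cis (t * Y \<omega>)"
      using lim by eventually_elim (auto simp: cis_conv_exp intro!: tendsto_intros)
  qed auto
  have \<phi>_real: "\<phi> t = complex_of_real (Re (\<phi> t))" and
    convR: "(\<lambda>n. exp (- t\<^sup>2 * s n / 2)) \<longlonglongrightarrow> Re (\<phi> t)" for t
  proof -
    have "(\<lambda>n. Im (complex_of_real (exp (- t\<^sup>2 * s n / 2)))) \<longlonglongrightarrow> Im (\<phi> t)"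
      by (intro tendsto_Im conv)
    then have "Im (\<phi> t) = 0"
      by (simp add: LIMSEQ_const_iff)
    then show "\<phi> t = complex_of_real (Re (\<phi> t))" by (simp add: complex_eq_iff)
    show "(\<lambda>n. exp (- t\<^sup>2 * s n / 2)) \<longlonglongrightarrow> Re (\<phi> t)"
      using tendsto_Re[OF conv[of t]] by simp
  qed
  have "(\<lambda>k. \<phi> (1 / Suc k)) \<longlonglongrightarrow> expectation (\<lambda>\<omega>. 1)"
    unfolding \<phi>_def
  proof (rule integral_dominated_convergence[where w="\<lambda>_. 1"])
    have "(\<lambda>k. cis (1 / Suc k * y)) \<longlonglongrightarrow> cis (0 * y)" for y
      unfolding cis_conv_exp by (intro tendsto_intros LIMSEQ_Suc[OF lim_const_over_n[of 1]])
    then show "AE \<omega> in M. (\<lambda>k. cis (1 / Suc k * Y \<omega>)) \<longlonglongrightarrow> 1"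
      by simp
  qed auto
  then have "eventually (\<lambda>k. \<phi> (1 / Suc k) \<noteq> 0) sequentially"
    by (rule tendsto_imp_eventually_ne) (simp add: prob_space)
  then obtain k where k: "\<phi> (1 / Suc k) \<noteq> 0"
    by (auto simp: eventually_sequentially)
  define t0 where "t0 = 1 / real (Suc k)"
  have t0: "t0 > 0" "\<phi> t0 \<noteq> 0" using k by (simp_all add: t0_def)
  define c where "c = Re (\<phi> t0)"
  have "c \<ge> 0" unfolding c_def
    by (rule LIMSEQ_le_const[OF convR]) auto
  then have c: "c > 0" using t0 \<phi>_real[of t0] unfolding c_def
    by (metis less_eq_real_def of_real_0)
  define S where "S = - 2 * ln c / t0\<^sup>2"
  have "(\<lambda>n. - 2 * ln (exp (- t0\<^sup>2 * s n / 2)) / t0\<^sup>2) \<longlonglongrightarrow> S"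
    unfolding S_def using c t0 convR[of t0] unfolding c_def[symmetric]
    by (intro tendsto_intros) auto
  then have sS: "s \<longlonglongrightarrow> S" using t0 by simp
  have "S \<ge> 0" by (rule LIMSEQ_le_const[OF sS]) (use s0 in auto)
  have "\<phi> t = complex_of_real (exp (- t\<^sup>2 * S / 2))" for t
  proof -
    have "(\<lambda>n. exp (- t\<^sup>2 * s n / 2)) \<longlonglongrightarrow> exp (- t\<^sup>2 * S / 2)"
      by (intro tendsto_intros sS) auto
    then show ?thesis using convR[of t] LIMSEQ_unique \<phi>_real by metis
  qed
  then have "centred_normal M Y \<and> expectation (\<lambda>\<omega>. (Y \<omega>)\<^sup>2) = S"
    using \<open>S \<ge> 0\<close> unfolding \<phi>_def by (intro centred_normal_if_char) auto
  with sS show "centred_normal M Y" 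
     "(\<lambda>n. expectation (\<lambda>\<omega>. (X n \<omega>)\<^sup>2)) \<longlonglongrightarrow> expectation (\<lambda>\<omega>. (Y \<omega>)\<^sup>2)"
    by (auto simp: s_def[abs_def])
qed

end

text \<open>A vector space of centred normal variables, so that every finite family in it is jointly Gaussian.\<close>

definition gaussian_space :: "'w measure \<Rightarrow> ('w \<Rightarrow> real) set \<Rightarrow> bool" where
  "gaussian_space M S \<longleftrightarrow> (\<forall>X\<in>S. centred_normal M X) \<and>
     (\<forall>X\<in>S. \<forall>Y\<in>S. \<forall>a b. (\<lambda>\<omega>. a * X \<omega> + b * Y \<omega>) \<in> S)"

definition ae_limits :: "'w measure \<Rightarrow> ('w \<Rightarrow> real) set \<Rightarrow> ('w \<Rightarrow> real) set" where
  "ae_limits M S = {X \<in> borel_measurable M.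
     \<exists>Y. (\<forall>n::nat. Y n \<in> S) \<and> (AE \<omega> in M. (\<lambda>n. Y n \<omega>) \<longlonglongrightarrow> X \<omega>)}"

lemma gaussian_space_lincomb:
  "gaussian_space M S \<Longrightarrow> X \<in> S \<Longrightarrow> Y \<in> S \<Longrightarrow> (\<lambda>\<omega>. a * X \<omega> + b * Y \<omega>) \<in> S"
  by (simp add: gaussian_space_def)

lemma gaussian_space_diff:
  "gaussian_space M S \<Longrightarrow> X \<in> S \<Longrightarrow> Y \<in> S \<Longrightarrow> (\<lambda>\<omega>. X \<omega> - Y \<omega>) \<in> S"
  using gaussian_space_lincomb[of M S X Y 1 "-1"] by simp

lemma gaussian_space_scale:
  "gaussian_space M S \<Longrightarrow> X \<in> S \<Longrightarrow> (\<lambda>\<omega>. a * X \<omega>) \<in> S"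
  using gaussian_space_lincomb[of M S X X a 0] by simp

lemma gaussian_space_sum:
  assumes S: "gaussian_space M S" and ne: "S \<noteq> {}" and "finite I" and X: "\<And>i. i \<in> I \<Longrightarrow> X i \<in> S"
  shows "(\<lambda>\<omega>. \<Sum>i\<in>I. c i * X i \<omega>) \<in> S"
  using \<open>finite I\<close> X
proof (induction I rule: finite_induct)
  case empty
  obtain Y where "Y \<in> S" using ne by auto
  from gaussian_space_scale[OF S this, of 0] show ?case by simp
next
  case (insert i I)
  then show ?case using gaussian_space_lincomb[OF S, of "X i" "\<lambda>\<omega>. \<Sum>i\<in>I. c i * X i \<omega>" "c i" 1] by simp
qed

lemma ae_limitsI:
  "X \<in> borel_measurable M \<Longrightarrow> (\<And>n. Y n \<in> S) \<Longrightarrow> AE \<omega> in M. (\<lambda>n. Y n \<omega>) \<longlonglongrightarrow> X \<omega> \<Longrightarrow> X \<in> ae_limits M S"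
  by (auto simp: ae_limits_def)

lemma gaussian_space_centred_normal: "gaussian_space M S \<Longrightarrow> X \<in> S \<Longrightarrow> centred_normal M X"
  by (simp add: gaussian_space_def)

lemma gaussian_space_measurable: "gaussian_space M S \<Longrightarrow> X \<in> S \<Longrightarrow> X \<in> borel_measurable M"
  by (simp add: gaussian_space_def centred_normal_def)

lemma gaussian_space_vector_measurable:
  fixes V :: "'w \<Rightarrow> 'b::euclidean_space"
  assumes S: "gaussian_space M S" and V: "\<And>v. (\<lambda>\<omega>. v \<bullet> V \<omega>) \<in> S"
  shows "V \<in> borel_measurable M"
proof (subst borel_measurable_euclidean_space, intro ballI)
  show "(\<lambda>\<omega>. V \<omega> \<bullet> b) \<in> borel_measurable M" for b
    using gaussian_space_measurable[OF S V[of b]] by (simp add: inner_commute)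
qed

lemma subset_ae_limits:
  assumes "gaussian_space M S" shows "S \<subseteq> ae_limits M S"
proof
  fix X assume "X \<in> S"
  then show "X \<in> ae_limits M S"
    using gaussian_space_measurable[OF assms] by (intro ae_limitsI[where Y="\<lambda>_. X"]) simp_all
qed

context prob_space begin

lemma gaussian_space_ae_limits:
  assumes "gaussian_space M S" shows "gaussian_space M (ae_limits M S)"
  unfolding gaussian_space_def
proof (intro conjI ballI allI)
  show "centred_normal M X" if X: "X \<in> ae_limits M S" for X
  proof -
    obtain Y where Y: "\<And>n::nat. Y n \<in> S" "AE \<omega> in M. (\<lambda>n. Y n \<omega>) \<longlonglongrightarrow> X \<omega>"
      using X by (auto simp: ae_limits_def)
    show ?thesis
      by (rule centred_normal_limit[OF gaussian_space_centred_normal[OF assms Y(1)] _ Y(2)])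
         (use X in \<open>simp add: ae_limits_def\<close>)
  qed
  fix X Y a b assume XY: "X \<in> ae_limits M S" "Y \<in> ae_limits M S"
  obtain X' where X': "\<And>n::nat. X' n \<in> S" "AE \<omega> in M. (\<lambda>n. X' n \<omega>) \<longlonglongrightarrow> X \<omega>"
    using XY by (auto simp: ae_limits_def)
  obtain Y' where Y': "\<And>n::nat. Y' n \<in> S" "AE \<omega> in M. (\<lambda>n. Y' n \<omega>) \<longlonglongrightarrow> Y \<omega>"
    using XY by (auto simp: ae_limits_def)
  show "(\<lambda>\<omega>. a * X \<omega> + b * Y \<omega>) \<in> ae_limits M S"
  proof (rule ae_limitsI)
    show "(\<lambda>\<omega>. a * X \<omega> + b * Y \<omega>) \<in> borel_measurable M"
      using XY by (auto simp: ae_limits_def)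
    show "(\<lambda>\<omega>. a * X' n \<omega> + b * Y' n \<omega>) \<in> S" for n
      using gaussian_space_lincomb[OF assms X'(1) Y'(1)] .
    show "AE \<omega> in M. (\<lambda>n. a * X' n \<omega> + b * Y' n \<omega>) \<longlonglongrightarrow> a * X \<omega> + b * Y \<omega>"
      using X'(2) Y'(2) by eventually_elim (intro tendsto_intros)
  qed
qed

lemma gaussian_space_integrable_mult:
  assumes S: "gaussian_space M S" and X: "X \<in> S" and Y: "Y \<in> S"
  shows "integrable M (\<lambda>\<omega>. X \<omega> * Y \<omega>)"
proof -
  have "integrable M (\<lambda>\<omega>. (1 * X \<omega> + 1 * Y \<omega>)\<^sup>2)" "integrable M (\<lambda>\<omega>. (1 * X \<omega> + - 1 * Y \<omega>)\<^sup>2)"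
    by (intro centred_normal_integrable_square gaussian_space_centred_normal[OF S] gaussian_space_lincomb[OF S X Y])+
  then have "integrable M (\<lambda>\<omega>. ((1 * X \<omega> + 1 * Y \<omega>)\<^sup>2 - (1 * X \<omega> + - 1 * Y \<omega>)\<^sup>2) / 4)"
    by (intro Bochner_Integration.integrable_diff integrable_divide_zero) auto
  also have "(\<lambda>\<omega>. ((1 * X \<omega> + 1 * Y \<omega>)\<^sup>2 - (1 * X \<omega> + - 1 * Y \<omega>)\<^sup>2) / 4) = (\<lambda>\<omega>. X \<omega> * Y \<omega>)"
    by (simp add: fun_eq_iff power2_eq_square algebra_simps)
  finally show ?thesis .
qed

lemma gaussian_space_polarization:
  assumes S: "gaussian_space M S" and X: "X \<in> S" and Y: "Y \<in> S"
  shows "expectation (\<lambda>\<omega>. X \<omega> * Y \<omega>) =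
    (expectation (\<lambda>\<omega>. (X \<omega> + Y \<omega>)\<^sup>2) - expectation (\<lambda>\<omega>. (X \<omega> - Y \<omega>)\<^sup>2)) / 4"
proof -
  note i = gaussian_space_integrable_mult[OF S]
  have "integrable M (\<lambda>\<omega>. (X \<omega>)\<^sup>2)" "integrable M (\<lambda>\<omega>. (Y \<omega>)\<^sup>2)" "integrable M (\<lambda>\<omega>. X \<omega> * Y \<omega>)"
    using i[OF X X] i[OF Y Y] i[OF X Y] by (simp_all add: power2_eq_square)
  then show ?thesis by (simp add: power2_sum power2_diff mult.assoc)
qed

text \<open>By polarization, covariances converge because variances do; the almost sure convergence inside a
  Gaussian space is automatically convergence in mean square.\<close>

lemma covariance_tendsto:
  assumes S: "gaussian_space M S" and X: "\<And>n::nat. X n \<in> S" and Y: "\<And>n. Y n \<in> S" 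
    and X': "X' \<in> S" and Y': "Y' \<in> S"
    and lim: "AE \<omega> in M. (\<lambda>n. X n \<omega>) \<longlonglongrightarrow> X' \<omega>" "AE \<omega> in M. (\<lambda>n. Y n \<omega>) \<longlonglongrightarrow> Y' \<omega>"
  shows "(\<lambda>n. expectation (\<lambda>\<omega>. X n \<omega> * Y n \<omega>)) \<longlonglongrightarrow> expectation (\<lambda>\<omega>. X' \<omega> * Y' \<omega>)"
proof -
  note meas = gaussian_space_measurable[OF S]
  have c: "centred_normal M (\<lambda>\<omega>. X n \<omega> + c * Y n \<omega>)" for n c
    using gaussian_space_lincomb[OF S X Y, of 1 n c n] S by (auto simp: gaussian_space_centred_normal)
  have "(\<lambda>n. expectation (\<lambda>\<omega>. (X n \<omega> + c * Y n \<omega>)\<^sup>2)) \<longlonglongrightarrow> expectation (\<lambda>\<omega>. (X' \<omega> + c * Y' \<omega>)\<^sup>2)" for c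
  proof (rule centred_normal_limit_variance[OF c])
    show "(\<lambda>\<omega>. X' \<omega> + c * Y' \<omega>) \<in> borel_measurable M"
      using meas[OF X'] meas[OF Y'] by simp
    show "AE \<omega> in M. (\<lambda>n. X n \<omega> + c * Y n \<omega>) \<longlonglongrightarrow> X' \<omega> + c * Y' \<omega>"
      using lim by eventually_elim (intro tendsto_intros)
  qed
  from this[of 1] this[of "-1"]
  have "(\<lambda>n. (expectation (\<lambda>\<omega>. (X n \<omega> + Y n \<omega>)\<^sup>2) - expectation (\<lambda>\<omega>. (X n \<omega> - Y n \<omega>)\<^sup>2)) / 4)
    \<longlonglongrightarrow> (expectation (\<lambda>\<omega>. (X' \<omega> + Y' \<omega>)\<^sup>2) - expectation (\<lambda>\<omega>. (X' \<omega> - Y' \<omega>)\<^sup>2)) / 4"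
    by (intro tendsto_intros) auto
  then show ?thesis
    by (simp add: gaussian_space_polarization[OF S X Y] gaussian_space_polarization[OF S X' Y'])
qed

lemma orthogonal_ae_limits:
  assumes S: "gaussian_space M S" and A: "A \<subseteq> S" and B: "B \<subseteq> S"
    and orth: "\<And>X Y. X \<in> A \<Longrightarrow> Y \<in> B \<Longrightarrow> expectation (\<lambda>\<omega>. X \<omega> * Y \<omega>) = 0"
    and X: "X \<in> ae_limits M A" and Y: "Y \<in> ae_limits M B"
  shows "expectation (\<lambda>\<omega>. X \<omega> * Y \<omega>) = 0"
proof -
  let ?T = "ae_limits M S"
  have mono: "ae_limits M A \<subseteq> ?T" "ae_limits M B \<subseteq> ?T" "S \<subseteq> ?T"
    using A B subset_ae_limits[OF S] unfolding ae_limits_def by blast+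
  obtain X' where X': "\<And>n::nat. X' n \<in> A" "AE \<omega> in M. (\<lambda>n. X' n \<omega>) \<longlonglongrightarrow> X \<omega>"
    using X by (auto simp: ae_limits_def)
  obtain Y' where Y': "\<And>n::nat. Y' n \<in> B" "AE \<omega> in M. (\<lambda>n. Y' n \<omega>) \<longlonglongrightarrow> Y \<omega>"
    using Y by (auto simp: ae_limits_def)
  have "(\<lambda>n. expectation (\<lambda>\<omega>. X' n \<omega> * Y' n \<omega>)) \<longlonglongrightarrow> expectation (\<lambda>\<omega>. X \<omega> * Y \<omega>)"
  proof (rule covariance_tendsto[OF gaussian_space_ae_limits[OF S] _ _ _ _ X'(2) Y'(2)])
    show "X' n \<in> ?T" "Y' n \<in> ?T" for n
      using X'(1)[of n] Y'(1)[of n] mono A B by auto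
    show "X \<in> ?T" "Y \<in> ?T"
      using X Y mono by auto
  qed
  then show ?thesis
    using orth[OF X'(1) Y'(1)] by (simp add: LIMSEQ_const_iff)
qed

text \<open>The variance of \<open>t * Z + v \<bullet> V\<close> splits into two summands, hence the characteristic function
  of the pair splits into two factors.\<close>

lemma uncorrelated_imp_joint_law_eq_product:
  fixes V :: "'a \<Rightarrow> 'b::euclidean_space"
  assumes S: "gaussian_space M S" and Z: "Z \<in> S" and V: "\<And>v. (\<lambda>\<omega>. v \<bullet> V \<omega>) \<in> S"
    and orth: "\<And>v. expectation (\<lambda>\<omega>. Z \<omega> * (v \<bullet> V \<omega>)) = 0"
  shows "distr M borel Z \<Otimes>\<^sub>M distr M borel V = distr M borel (\<lambda>\<omega>. (Z \<omega>, V \<omega>))"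
proof (rule joint_law_eq_product_if_char_factors)
  show "Z \<in> borel_measurable M" using S Z by (rule gaussian_space_measurable)
  show "V \<in> borel_measurable M" by (rule gaussian_space_vector_measurable[OF S V])
  fix t v
  note gi = gaussian_space_integrable_mult[OF S]
  have i: "integrable M (\<lambda>\<omega>. (Z \<omega>)\<^sup>2)" "integrable M (\<lambda>\<omega>. (v \<bullet> V \<omega>)\<^sup>2)" "integrable M (\<lambda>\<omega>. Z \<omega> * (v \<bullet> V \<omega>))"
    using gi[OF Z Z] gi[OF V V, of v v] gi[OF Z V, of v] by (simp_all add: power2_eq_square)
  have "expectation (\<lambda>\<omega>. (t * Z \<omega> + 1 * (v \<bullet> V \<omega>))\<^sup>2) =
      expectation (\<lambda>\<omega>. t\<^sup>2 * (Z \<omega>)\<^sup>2 + (v \<bullet> V \<omega>)\<^sup>2 + 2 * t * (Z \<omega> * (v \<bullet> V \<omega>)))"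
    by (simp add: power2_eq_square algebra_simps)
  also have "\<dots> = t\<^sup>2 * expectation (\<lambda>\<omega>. (Z \<omega>)\<^sup>2) + expectation (\<lambda>\<omega>. (v \<bullet> V \<omega>)\<^sup>2)"
    using i orth[of v] by simp
  finally have var: "expectation (\<lambda>\<omega>. (t * Z \<omega> + 1 * (v \<bullet> V \<omega>))\<^sup>2) = \<dots>" .
  have "expectation (\<lambda>\<omega>. cis (1 * (t * Z \<omega> + 1 * (v \<bullet> V \<omega>)))) =
     exp (- 1\<^sup>2 * expectation (\<lambda>\<omega>. (t * Z \<omega> + 1 * (v \<bullet> V \<omega>))\<^sup>2) / 2)"
    by (rule centred_normal_char, rule gaussian_space_centred_normal[OF S], rule gaussian_space_lincomb[OF S Z V])
  also have "\<dots> = complex_of_real (exp (- t\<^sup>2 * expectation (\<lambda>\<omega>. (Z \<omega>)\<^sup>2) / 2)) *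
      complex_of_real (exp (- 1\<^sup>2 * expectation (\<lambda>\<omega>. (v \<bullet> V \<omega>)\<^sup>2) / 2))"
    unfolding var by (simp add: add_divide_distrib diff_divide_distrib flip: of_real_mult exp_add)
  also have "\<dots> = expectation (\<lambda>\<omega>. cis (t * Z \<omega>)) * expectation (\<lambda>\<omega>. cis (1 * (v \<bullet> V \<omega>)))"
    by (simp only: centred_normal_char[OF gaussian_space_centred_normal[OF S Z]]
        centred_normal_char[OF gaussian_space_centred_normal[OF S V]])
  finally show "expectation (\<lambda>\<omega>. cis (t * Z \<omega> + v \<bullet> V \<omega>)) =
      expectation (\<lambda>\<omega>. cis (t * Z \<omega>)) * expectation (\<lambda>\<omega>. cis (v \<bullet> V \<omega>))"
    by simp
qed

end

section \<open>Gaussian integration by parts\<close>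

lemma (in prob_space) gaussian_space_AE_zero:
  assumes S: "gaussian_space M S" and Z: "Z \<in> S"
  shows "(AE \<omega> in M. Z \<omega> = 0) \<longleftrightarrow> expectation (\<lambda>\<omega>. (Z \<omega>)\<^sup>2) = 0"
proof -
  have "integrable M (\<lambda>\<omega>. (Z \<omega>)\<^sup>2)"
    using S Z by (intro centred_normal_integrable_square gaussian_space_centred_normal)
  from integral_nonneg_eq_0_iff_AE[OF this] show ?thesis by simp
qed

lemma normal_density_tendsto_0:
  assumes "\<sigma> > 0"
  shows "((\<lambda>z. c * normal_density 0 \<sigma> z) \<longlongrightarrow> 0) at_top" "((\<lambda>z. c * normal_density 0 \<sigma> z) \<longlongrightarrow> 0) at_bot"
proof -
  have "((\<lambda>z. c * (1 / sqrt (2 * pi * \<sigma>\<^sup>2) * exp (- (1 / (2 * \<sigma>\<^sup>2)) * z\<^sup>2))) \<longlongrightarrow> c * (1 / sqrt (2 * pi * \<sigma>\<^sup>2) * 0)) F"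
    if "filterlim (\<lambda>z::real. z\<^sup>2) at_top F" for F
  proof (intro tendsto_intros)
    have "filterlim (\<lambda>z. (1 / (2 * \<sigma>\<^sup>2)) * z\<^sup>2) at_top F"
      using assms that by (intro filterlim_tendsto_pos_mult_at_top[OF tendsto_const]) auto
    then show "((\<lambda>z. exp (- (1 / (2 * \<sigma>\<^sup>2)) * z\<^sup>2)) \<longlongrightarrow> 0) F"
      by (intro filterlim_compose[OF exp_at_bot]) (simp add: filterlim_uminus_at_top)
  qed
  note * = this
  show "((\<lambda>z. c * normal_density 0 \<sigma> z) \<longlongrightarrow> 0) at_top"
    using *[of at_top] filterlim_pow_at_top[of 2 "\<lambda>x::real. x" at_top]
    by (simp add: normal_density_def filterlim_ident)
  show "((\<lambda>z. c * normal_density 0 \<sigma> z) \<longlongrightarrow> 0) at_bot"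
    using *[of at_bot] filterlim_pow_at_bot_even[of 2 "\<lambda>x::real. x" at_bot]
    by (simp add: normal_density_def filterlim_ident)
qed

context prob_space begin

text \<open>Integration by parts: \<open>- \<sigma>\<^sup>2 * normal_density 0 \<sigma> z * h z\<close> vanishes at both ends of the line and has derivative
  \<open>normal_density 0 \<sigma> z * (z * h z - \<sigma>\<^sup>2 * h' z)\<close>.\<close>

lemma stein_normal:
  fixes h h' :: "real \<Rightarrow> real"
  assumes Z: "centred_normal M Z"
    and h: "\<And>z. (h has_real_derivative h' z) (at z)" and h'_cont: "continuous_on UNIV h'"
    and bnd: "\<And>z. \<bar>h z\<bar> \<le> B" "\<And>z. \<bar>h' z\<bar> \<le> B"
  shows "expectation (\<lambda>\<omega>. Z \<omega> * h (Z \<omega>)) = expectation (\<lambda>\<omega>. (Z \<omega>)\<^sup>2) * expectation (\<lambda>\<omega>. h' (Z \<omega>))"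
proof (cases "AE \<omega> in M. Z \<omega> = 0")
  case True
  have h_cont: "continuous_on UNIV h"
    using h by (meson DERIV_isCont continuous_at_imp_continuous_on)
  have [measurable]: "Z \<in> borel_measurable M" "h \<in> borel_measurable borel"
    using Z h_cont by (auto simp: centred_normal_def borel_measurable_continuous_onI)
  have "expectation (\<lambda>\<omega>. Z \<omega> * h (Z \<omega>)) = expectation (\<lambda>_. 0)" "expectation (\<lambda>\<omega>. (Z \<omega>)\<^sup>2) = expectation (\<lambda>_. 0)"
    using True by (intro integral_cong_AE; auto)+
  then show ?thesis by simp
next
  case False
  then obtain \<sigma> where \<sigma>: "\<sigma> > 0" and D: "distributed M lborel Z (normal_density 0 \<sigma>)"
    using Z by (auto simp: centred_normal_def)
  let ?\<phi> = "normal_density 0 \<sigma>"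
  have h_cont: "continuous_on UNIV h"
    using h by (meson DERIV_isCont continuous_at_imp_continuous_on)
  have [measurable]: "h \<in> borel_measurable borel" "h' \<in> borel_measurable borel"
    using h_cont h'_cont by (auto intro: borel_measurable_continuous_onI)
  have var: "expectation (\<lambda>\<omega>. (Z \<omega>)\<^sup>2) = \<sigma>\<^sup>2"
    using normal_distributed_variance[OF \<sigma> D] normal_distributed_expectation[OF \<sigma> D] by simp
  have i1: "integrable lborel (\<lambda>z. ?\<phi> z * (z * h z))"
  proof (rule Bochner_Integration.integrable_bound)
    show "integrable lborel (\<lambda>z. B * (?\<phi> z * z))"
      using integrable_normal_moment_nz_1[OF \<sigma>, of 0] by (rule integrable_mult_right)
    have "norm (?\<phi> z * (z * h z)) \<le> norm (B * (?\<phi> z * z))" for z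
      using bnd(1)[of z] mult_left_mono[of "\<bar>h z\<bar>" B "?\<phi> z * \<bar>z\<bar>"] 
      by (simp add: abs_mult normal_density_nonneg mult_ac)
    then show "AE z in lborel. norm (?\<phi> z * (z * h z)) \<le> norm (B * (?\<phi> z * z))" by simp
  qed simp
  have i2: "integrable lborel (\<lambda>z. ?\<phi> z * h' z)"
  proof (rule Bochner_Integration.integrable_bound)
    show "integrable lborel (\<lambda>z. B * ?\<phi> z)"
      using integrable_normal_density[OF \<sigma>, of 0] by (rule integrable_mult_right)
    have "norm (?\<phi> z * h' z) \<le> norm (B * ?\<phi> z)" for z
      using bnd(2)[of z] mult_left_mono[of "\<bar>h' z\<bar>" B "?\<phi> z"] 
      by (simp add: abs_mult normal_density_nonneg mult_ac)
    then show "AE z in lborel. norm (?\<phi> z * h' z) \<le> norm (B * ?\<phi> z)" by simp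
  qed simp
  define F where "F z = - \<sigma>\<^sup>2 * (?\<phi> z * h z)" for z
  define f where "f z = ?\<phi> z * (z * h z) - \<sigma>\<^sup>2 * (?\<phi> z * h' z)" for z
  have D\<phi>: "(?\<phi> has_real_derivative - z / \<sigma>\<^sup>2 * ?\<phi> z) (at z)" for z
    unfolding normal_density_def using \<sigma>
    by (auto intro!: derivative_eq_intros simp: field_simps power2_eq_square)
  have F: "(F has_real_derivative f z) (at z)" for z
    unfolding F_def f_def using \<sigma>
    by (auto intro!: derivative_eq_intros D\<phi> h simp: field_simps)
  have "(LBINT x=-\<infinity>..\<infinity>. f x) = 0 - 0"
  proof (rule interval_integral_FTC_integrable)
    show "(F has_vector_derivative f x) (at x)" for x
      using F has_real_derivative_iff_has_vector_derivative by blast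
    have "continuous_on UNIV ?\<phi>"
      using D\<phi> by (meson DERIV_isCont continuous_at_imp_continuous_on)
    then have "continuous_on UNIV f"
      unfolding f_def using h_cont h'_cont by (intro continuous_intros)
    then show "isCont f x" for x
      by (simp add: continuous_on_eq_continuous_at)
    show "set_integrable lborel (einterval (- \<infinity>) \<infinity>) f"
      using i1 i2 by (simp add: set_integrable_def f_def)
    have Fb: "norm (F z) \<le> \<sigma>\<^sup>2 * B * ?\<phi> z" for z
      using bnd(1)[of z] mult_left_mono[of "\<bar>h z\<bar>" B "\<sigma>\<^sup>2 * ?\<phi> z"] 
      by (simp add: F_def abs_mult normal_density_nonneg mult_ac)
    have ev: "eventually (\<lambda>z. norm (F z) \<le> \<sigma>\<^sup>2 * B * ?\<phi> z) G" for G
      using Fb by (intro always_eventually allI)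
    have "(F \<longlongrightarrow> 0) at_top" "(F \<longlongrightarrow> 0) at_bot"
      by (rule Lim_null_comparison[OF ev], rule normal_density_tendsto_0[OF \<sigma>])+
    then show "((F \<circ> real_of_ereal) \<longlongrightarrow> 0) (at_right (-\<infinity>))" "((F \<circ> real_of_ereal) \<longlongrightarrow> 0) (at_left \<infinity>)"
      by (simp_all add: ereal_tendsto_simps)
  qed simp
  then have "(\<integral>z. f z \<partial>lborel) = 0"
    by (simp add: interval_lebesgue_integral_def set_lebesgue_integral_def)
  then have "(\<integral>z. ?\<phi> z * (z * h z) \<partial>lborel) = \<sigma>\<^sup>2 * (\<integral>z. ?\<phi> z * h' z \<partial>lborel)"
    using i1 i2 by (simp add: f_def)
  then show ?thesis
    using distributed_integral[OF D, of "\<lambda>z. z * h z"] distributed_integral[OF D, of h'] var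
    by (simp add: normal_density_nonneg)
qed

text \<open>For nondegenerate \<open>Z\<close>, writing \<open>V = W + Z *\<^sub>R c\<close> with \<open>c\<close> the regression coefficient of \<open>V\<close> on \<open>Z\<close> makes \<open>W\<close> independent of \<open>Z\<close>.
  For a fixed value of \<open>W\<close> this is the one-dimensional identity along the line in direction \<open>c\<close>,
  and Fubini's theorem integrates over \<open>W\<close>.\<close>

lemma stein_gaussian_space:
  fixes V :: "'a \<Rightarrow> 'b::euclidean_space" and F :: "'b \<Rightarrow> real"
  assumes S: "gaussian_space M S" and Z: "Z \<in> S" and V: "\<And>v. (\<lambda>\<omega>. v \<bullet> V \<omega>) \<in> S"
    and m: "\<And>v. expectation (\<lambda>\<omega>. Z \<omega> * (v \<bullet> V \<omega>)) = v \<bullet> m"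
    and F: "\<And>v. GDERIV F v :> DF v" and DF_cont: "continuous_on UNIV DF"
    and bnd: "\<And>v. \<bar>F v\<bar> \<le> B" "\<And>v. norm (DF v) \<le> B"
  shows "expectation (\<lambda>\<omega>. Z \<omega> * F (V \<omega>)) = expectation (\<lambda>\<omega>. m \<bullet> DF (V \<omega>))"
proof -
  define s where "s = expectation (\<lambda>\<omega>. (Z \<omega>)\<^sup>2)"
  have F_cont: "continuous_on UNIV F"
    using F unfolding gderiv_def by (meson has_derivative_continuous continuous_at_imp_continuous_on)
  have Zm[measurable]: "Z \<in> borel_measurable M" using S Z by (rule gaussian_space_measurable)
  have [measurable]: "V \<in> borel_measurable M"
    by (rule gaussian_space_vector_measurable[OF S V])
  have [measurable]: "F \<in> borel_measurable borel" "DF \<in> borel_measurable borel"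
    using F_cont DF_cont by (auto intro: borel_measurable_continuous_onI)
  show ?thesis
  proof (cases "s = 0")
    case True
    then have Z0: "AE \<omega> in M. Z \<omega> = 0"
      using gaussian_space_AE_zero[OF S Z] by (simp add: s_def)
    then have "v \<bullet> m = expectation (\<lambda>\<omega>. 0)" for v
      unfolding m[symmetric] by (intro integral_cong_AE) auto
    then have "m = 0" using inner_eq_zero_iff[of m] by simp
    moreover have "expectation (\<lambda>\<omega>. Z \<omega> * F (V \<omega>)) = expectation (\<lambda>\<omega>. 0)"
      using Z0 by (intro integral_cong_AE) auto
    ultimately show ?thesis by simp
  next
    case False
    define c where "c = m /\<^sub>R s"
    define W where "W \<omega> = V \<omega> - Z \<omega> *\<^sub>R c" for \<omega>
    have VW: "V \<omega> = W \<omega> + Z \<omega> *\<^sub>R c" for \<omega> by (simp add: W_def)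
    have [measurable]: "W \<in> borel_measurable M" unfolding W_def by measurable
    have joint: "distr M borel Z \<Otimes>\<^sub>M distr M borel W = distr M borel (\<lambda>\<omega>. (Z \<omega>, W \<omega>))"
    proof (rule uncorrelated_imp_joint_law_eq_product[OF S Z])
      fix v
      show "(\<lambda>\<omega>. v \<bullet> W \<omega>) \<in> S"
        using gaussian_space_lincomb[OF S V[of v] Z, of 1 "- (v \<bullet> c)"]
        by (simp add: W_def inner_diff_right mult.commute)
      have "expectation (\<lambda>\<omega>. Z \<omega> * (v \<bullet> W \<omega>)) = expectation (\<lambda>\<omega>. Z \<omega> * (v \<bullet> V \<omega>) - (v \<bullet> c) * (Z \<omega>)\<^sup>2)"
        by (simp add: W_def inner_diff_right algebra_simps power2_eq_square)
      also have "\<dots> = v \<bullet> m - (v \<bullet> c) * s"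
        using gaussian_space_integrable_mult[OF S Z V[of v]] gaussian_space_integrable_mult[OF S Z Z]
        by (simp add: m s_def power2_eq_square)
      also have "\<dots> = 0" using False by (simp add: c_def)
      finally show "expectation (\<lambda>\<omega>. Z \<omega> * (v \<bullet> W \<omega>)) = 0" .
    qed
    interpret Z: prob_space "distr M borel Z" by (rule prob_space_distr) simp
    interpret W: prob_space "distr M borel W" by (rule prob_space_distr) simp
    interpret ZW: pair_prob_space "distr M borel Z" "distr M borel W" ..
    have fub: "expectation (\<lambda>\<omega>. g (Z \<omega>, W \<omega>)) = (\<integral>w. expectation (\<lambda>\<omega>. g (Z \<omega>, w)) \<partial>distr M borel W)"
      if [measurable]: "g \<in> borel_measurable borel" and int: "integrable M (\<lambda>\<omega>. g (Z \<omega>, W \<omega>))"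
      for g :: "real \<times> 'b \<Rightarrow> real"
    proof -
      have [measurable]: "g \<in> borel_measurable (borel \<Otimes>\<^sub>M borel)" by (simp add: borel_prod)
      have "expectation (\<lambda>\<omega>. g (Z \<omega>, W \<omega>)) = integral\<^sup>L (distr M borel (\<lambda>\<omega>. (Z \<omega>, W \<omega>))) g"
        by (simp add: integral_distr)
      also have "\<dots> = integral\<^sup>L (distr M borel Z \<Otimes>\<^sub>M distr M borel W) (\<lambda>(x, y). g (x, y))"
        by (simp add: joint)
      also have "\<dots> = (\<integral>w. (\<integral>z. g (z, w) \<partial>distr M borel Z) \<partial>distr M borel W)"
        using int by (intro ZW.integral_snd[symmetric]) (simp add: joint integrable_distr_eq)
      also have "\<dots> = (\<integral>w. expectation (\<lambda>\<omega>. g (Z \<omega>, w)) \<partial>distr M borel W)"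
        by (intro Bochner_Integration.integral_cong) (simp_all add: integral_distr)
      finally show ?thesis .
    qed
    have inner: "expectation (\<lambda>\<omega>. Z \<omega> * F (w + Z \<omega> *\<^sub>R c)) = s * expectation (\<lambda>\<omega>. c \<bullet> DF (w + Z \<omega> *\<^sub>R c))" for w
      unfolding s_def
    proof (rule stein_normal[OF gaussian_space_centred_normal[OF S Z], 
          where h = "\<lambda>z. F (w + z *\<^sub>R c)" and h' = "\<lambda>z. c \<bullet> DF (w + z *\<^sub>R c)" and B = "max B (norm c * B)"])
      fix z
      have "((\<lambda>z. F (w + z *\<^sub>R c)) has_derivative (\<lambda>t. (t *\<^sub>R c) \<bullet> DF (w + z *\<^sub>R c))) (at z)"
        by (rule has_derivative_compose[OF _ F[unfolded gderiv_def], of "\<lambda>z. w + z *\<^sub>R c" "\<lambda>t. t *\<^sub>R c"])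
           (auto intro!: derivative_eq_intros)
      then show "((\<lambda>z. F (w + z *\<^sub>R c)) has_real_derivative c \<bullet> DF (w + z *\<^sub>R c)) (at z)"
        by (simp add: has_field_derivative_def mult.commute[of _ "c \<bullet> _"] mult_commute_abs)
      show "\<bar>F (w + z *\<^sub>R c)\<bar> \<le> max B (norm c * B)" using bnd(1)[of "w + z *\<^sub>R c"] by simp
      have "\<bar>c \<bullet> DF (w + z *\<^sub>R c)\<bar> \<le> norm c * norm (DF (w + z *\<^sub>R c))"
        by (rule Cauchy_Schwarz_ineq2)
      also have "\<dots> \<le> norm c * B" by (intro mult_left_mono bnd) simp
      finally show "\<bar>c \<bullet> DF (w + z *\<^sub>R c)\<bar> \<le> max B (norm c * B)" by simp
    next
      show "continuous_on UNIV (\<lambda>z. c \<bullet> DF (w + z *\<^sub>R c))"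
        by (intro continuous_intros continuous_on_compose2[OF DF_cont]) auto
    qed
    have "expectation (\<lambda>\<omega>. Z \<omega> * F (V \<omega>)) = expectation (\<lambda>\<omega>. (case (Z \<omega>, W \<omega>) of (z, w) \<Rightarrow> z * F (w + z *\<^sub>R c)))"
      by (simp add: VW)
    also have "\<dots> = (\<integral>w. expectation (\<lambda>\<omega>. Z \<omega> * F (w + Z \<omega> *\<^sub>R c)) \<partial>distr M borel W)"
    proof (subst fub)
      have "integrable M (\<lambda>\<omega>. B * Z \<omega>)"
        using centred_normal_integrable[OF gaussian_space_centred_normal[OF S Z]] by simp
      then show "integrable M (\<lambda>\<omega>. case (Z \<omega>, W \<omega>) of (z, w) \<Rightarrow> z * F (w + z *\<^sub>R c))"
      proof (rule Bochner_Integration.integrable_bound)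
        have "norm (Z \<omega> * F (V \<omega>)) \<le> norm (B * Z \<omega>)" for \<omega>
          using bnd(1)[of "V \<omega>"] mult_left_mono[of "\<bar>F (V \<omega>)\<bar>" B "\<bar>Z \<omega>\<bar>"] by (simp add: abs_mult mult_ac)
        then show "AE \<omega> in M. norm (case (Z \<omega>, W \<omega>) of (z, w) \<Rightarrow> z * F (w + z *\<^sub>R c)) \<le> norm (B * Z \<omega>)"
          by (simp add: VW)
      qed simp
    qed (simp_all add: borel_prod[symmetric])
    also have "\<dots> = s * (\<integral>w. expectation (\<lambda>\<omega>. c \<bullet> DF (w + Z \<omega> *\<^sub>R c)) \<partial>distr M borel W)"
      by (simp add: inner)
    also have "(\<integral>w. expectation (\<lambda>\<omega>. c \<bullet> DF (w + Z \<omega> *\<^sub>R c)) \<partial>distr M borel W) = 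
        expectation (\<lambda>\<omega>. (case (Z \<omega>, W \<omega>) of (z, w) \<Rightarrow> c \<bullet> DF (w + z *\<^sub>R c)))"
    proof (subst fub)
      show "integrable M (\<lambda>\<omega>. case (Z \<omega>, W \<omega>) of (z, w) \<Rightarrow> c \<bullet> DF (w + z *\<^sub>R c))"
      proof (rule integrable_const_bound[where B="norm c * B"])
        have "\<bar>c \<bullet> DF v\<bar> \<le> norm c * B" for v
          using Cauchy_Schwarz_ineq2[of c "DF v"] mult_left_mono[OF bnd(2)[of v], of "norm c"] by simp
        then show "AE \<omega> in M. norm (case (Z \<omega>, W \<omega>) of (z, w) \<Rightarrow> c \<bullet> DF (w + z *\<^sub>R c)) \<le> norm c * B"
          by simp
      qed simp
    qed (simp_all add: borel_prod[symmetric])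
    also have "s * \<dots> = expectation (\<lambda>\<omega>. m \<bullet> DF (V \<omega>))"
      using False by (simp only: prod.case VW[symmetric]) (simp add: c_def)
    finally show ?thesis .
  qed
qed

end

section \<open>The mean norm of a Gaussian vector\<close>

text \<open>The Jacobian matrix of \<open>v \<mapsto> v / norm v\<close> at \<open>v \<noteq> 0\<close>.\<close>

definition unit_jac :: "'n \<Rightarrow> 'n \<Rightarrow> real^'n \<Rightarrow> real" where
  "unit_jac i j v = (if i = j then 1 else 0) / norm v - v $ i * v $ j / norm v ^ 3"

lemma borel_measurable_unit_jac [measurable]: "unit_jac i j \<in> borel_measurable borel"
  unfolding unit_jac_def by measurable

lemma abs_unit_jac_le: "\<bar>unit_jac i j v\<bar> \<le> 2 * (1 / norm v)"
proof (cases "v = 0")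
  case False
  have "\<bar>v $ i * v $ j / norm v ^ 3\<bar> = (\<bar>v $ i\<bar> * \<bar>v $ j\<bar>) / norm v ^ 3"
    by (simp add: abs_mult)
  also have "\<dots> \<le> (norm v * norm v) / norm v ^ 3"
    by (intro divide_right_mono mult_mono component_le_norm_cart) auto
  also have "\<dots> = 1 / norm v" using False by (simp add: power3_eq_cube)
  finally have "\<bar>v $ i * v $ j / norm v ^ 3\<bar> \<le> 1 / norm v" .
  moreover have "\<bar>(if i = j then 1 else 0) / norm v\<bar> \<le> 1 / norm v" by simp
  ultimately show ?thesis
    unfolding unit_jac_def using abs_triangle_ineq4[of "(if i = j then 1 else 0) / norm v" "v $ i * v $ j / norm v ^ 3"]
    by linarith
qed (simp add: unit_jac_def)

context prob_space begin

text \<open>Near the origin the density is bounded and the singularity is integrable; for \<open>\<bar>z\<bar> > 1\<close> the integrand is at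
  most the density itself.\<close>

lemma integrable_inverse_sqrt_normal:
  assumes Z: "centred_normal M Z" and nz: "\<not> (AE \<omega> in M. Z \<omega> = 0)"
  shows "integrable M (\<lambda>\<omega>. \<bar>Z \<omega>\<bar> powr (-1/2))"
proof -
  obtain \<sigma> where \<sigma>: "\<sigma> > 0" and D: "distributed M lborel Z (normal_density 0 \<sigma>)"
    using Z nz by (auto simp: centred_normal_def)
  let ?\<phi> = "normal_density 0 \<sigma>"
  define C where "C = 1 / sqrt (2 * pi * \<sigma>\<^sup>2)"
  have C: "?\<phi> z \<le> C" "0 \<le> C" for z
  proof -
    have "exp (- z\<^sup>2 / (2 * \<sigma>\<^sup>2)) \<le> 1" by simp
    then show "?\<phi> z \<le> C" unfolding C_def normal_density_def by (simp add: divide_right_mono)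
  qed (simp add: C_def)
  define g where "g z = (if z \<in> {0..1} then z powr (-1/2) else 0)" for z :: real
  have [measurable]: "g \<in> borel_measurable borel" unfolding g_def by measurable
  have "((\<lambda>z::real. z powr (-1/2)) has_integral (1 powr (-1/2+1) / (-1/2+1))) {0..1}"
    by (rule has_integral_powr_from_0) auto
  then have "(g has_integral 2) UNIV"
    unfolding g_def[abs_def] by (subst has_integral_restrict_UNIV) simp
  then have "integral\<^sup>N lborel g = ennreal 2"
    by (rule nn_integral_has_integral_lborel[rotated 2]) (auto simp: g_def)
  then have g: "integrable lborel g"
    by (intro integrableI_nonneg) (auto simp: g_def)
  have g': "integrable lborel (\<lambda>z. g (- z))"
    using lborel_integrable_real_affine[OF g, of "-1" 0] by simp
  have "integrable lborel (\<lambda>z. ?\<phi> z * \<bar>z\<bar> powr (-1/2))"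
  proof (rule Bochner_Integration.integrable_bound)
    show "integrable lborel (\<lambda>z. ?\<phi> z + C * (g z + g (- z)))"
      using g g' \<sigma> by simp
    have "norm (?\<phi> z * \<bar>z\<bar> powr (-1/2)) \<le> norm (?\<phi> z + C * (g z + g (- z)))" for z
    proof (cases "\<bar>z\<bar> \<le> 1")
      case True
      have "?\<phi> z * \<bar>z\<bar> powr (-1/2) \<le> C * \<bar>z\<bar> powr (-1/2)"
        using C by (intro mult_right_mono) auto
      also have "\<bar>z\<bar> powr (-1/2) \<le> g z + g (- z)"
        using True by (auto simp: g_def)
      finally have "?\<phi> z * \<bar>z\<bar> powr (-1/2) \<le> C * (g z + g (- z))"
        using C by (simp add: mult_left_mono)
      then have "?\<phi> z * \<bar>z\<bar> powr (-1/2) \<le> ?\<phi> z + C * (g z + g (- z))"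
        using normal_density_nonneg[of 0 \<sigma> z] by linarith
      also have "\<dots> \<le> norm (?\<phi> z + C * (g z + g (- z)))" by simp
      finally show ?thesis
        using normal_density_nonneg[of 0 \<sigma> z] by (simp add: abs_mult)
    next
      case False
      then have "\<bar>z\<bar> powr (-1/2) \<le> 1 powr (-1/2)"
        by (intro powr_mono2') auto
      then have "?\<phi> z * \<bar>z\<bar> powr (-1/2) \<le> ?\<phi> z"
        by (simp add: mult_left_le normal_density_nonneg)
      moreover have "g z = 0" "g (-z) = 0" using False by (auto simp: g_def)
      ultimately show ?thesis
        using normal_density_nonneg[of 0 \<sigma> z] by (simp add: abs_mult)
    qed
    then show "AE z in lborel. norm (?\<phi> z * \<bar>z\<bar> powr (-1/2)) \<le> norm (?\<phi> z + C * (g z + g (- z)))"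
      by simp
  qed simp
  then show ?thesis
    using distributed_integrable[OF D, of "\<lambda>z. \<bar>z\<bar> powr (-1/2)"] by (simp add: normal_density_nonneg)
qed

text \<open>This is where the dimension matters: in one dimension \<open>1 / \<bar>V\<bar>\<close> has infinite mean. Two coordinates of \<open>V\<close>
  give independent nondegenerate normal variables \<open>X\<close> and \<open>Y\<close> (Gram-Schmidt), and \<open>norm V\<close> dominates a multiple of
  \<open>sqrt (X\<^sup>2 + Y\<^sup>2)\<close>, hence of \<open>sqrt (\<bar>X\<bar> * \<bar>Y\<bar>)\<close>. The mean of the inverse then factors into two
  one-dimensional integrals with the integrable singularity \<open>\<bar>z\<bar> powr (-1/2)\<close>.\<close>

lemma integrable_inverse_norm_gaussian:
  fixes V :: "'a \<Rightarrow> real^'n"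
  assumes S: "gaussian_space M S" and V: "\<And>v. (\<lambda>\<omega>. v \<bullet> V \<omega>) \<in> S"
    and nz: "\<And>v. v \<noteq> 0 \<Longrightarrow> AE \<omega> in M. v \<bullet> V \<omega> \<noteq> 0" and card: "CARD('n) \<ge> 2"
  shows "integrable M (\<lambda>\<omega>. 1 / norm (V \<omega>))"
proof -
  have [measurable]: "V \<in> borel_measurable M"
    by (rule gaussian_space_vector_measurable[OF S V])
  obtain i j :: 'n where ij: "i \<noteq> j"
  proof -
    have "\<not> (\<forall>i j::'n. i = j)"
      using card card_le_Suc0_iff_eq[of "UNIV::'n set"] by auto
    then show ?thesis using that by blast
  qed
  define X where "X \<omega> = V \<omega> $ i" for \<omega>
  define s where "s = expectation (\<lambda>\<omega>. (X \<omega>)\<^sup>2)"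
  define c where "c = expectation (\<lambda>\<omega>. X \<omega> * V \<omega> $ j) / s"
  define Y where "Y \<omega> = V \<omega> $ j - c * X \<omega>" for \<omega>
  have comp: "(\<lambda>\<omega>. V \<omega> $ k) \<in> S" for k
    using V[of "axis k 1"] by (simp add: inner_axis')
  note [measurable] = gaussian_space_measurable[OF S comp]
  have XS: "X \<in> S" using comp[of i] by (simp add: X_def[abs_def])
  have YS: "Y \<in> S" using gaussian_space_lincomb[OF S comp[of j] XS, of 1 "-c"] by (simp add: Y_def[abs_def])
  have [measurable]: "X \<in> borel_measurable M" "Y \<in> borel_measurable M"
    using XS YS gaussian_space_measurable[OF S] by auto
  have Xnz: "AE \<omega> in M. X \<omega> \<noteq> 0"
    using nz[of "axis i 1"] by (simp add: inner_axis' X_def)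
  have Ynz: "AE \<omega> in M. Y \<omega> \<noteq> 0"
  proof -
    have "(axis j 1 - c *\<^sub>R axis i 1 :: real^'n) $ j = 1"
      using ij by (simp add: axis_def)
    then have "axis j 1 - c *\<^sub>R axis i 1 \<noteq> (0 :: real^'n)"
      by (metis zero_index zero_neq_one)
    from nz[OF this] show ?thesis
      by (simp add: inner_diff_left inner_axis' X_def Y_def)
  qed
  have not0: "\<not> (AE \<omega> in M. U \<omega> = 0)" if "AE \<omega> in M. U \<omega> \<noteq> 0" for U :: "'a \<Rightarrow> real"
  proof
    assume "AE \<omega> in M. U \<omega> = 0"
    with that have "AE \<omega> in M. False" by eventually_elim simp
    then show False by simp
  qed
  have s0: "s \<noteq> 0"
    using gaussian_space_AE_zero[OF S XS] not0[OF Xnz] by (simp add: s_def)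
  have orth: "expectation (\<lambda>\<omega>. X \<omega> * (v \<bullet> Y \<omega>)) = 0" for v
  proof -
    have "expectation (\<lambda>\<omega>. X \<omega> * (v \<bullet> Y \<omega>)) = 
      expectation (\<lambda>\<omega>. v * (X \<omega> * V \<omega> $ j) - v * c * (X \<omega>)\<^sup>2)"
      by (simp add: Y_def algebra_simps power2_eq_square)
    also have "\<dots> = v * expectation (\<lambda>\<omega>. X \<omega> * V \<omega> $ j) - v * c * s"
      using gaussian_space_integrable_mult[OF S XS comp[of j]] gaussian_space_integrable_mult[OF S XS XS]
      by (simp add: s_def power2_eq_square)
    finally show ?thesis using s0 by (simp add: c_def)
  qed
  have joint: "distr M borel X \<Otimes>\<^sub>M distr M borel Y = distr M borel (\<lambda>\<omega>. (X \<omega>, Y \<omega>))"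
    using gaussian_space_scale[OF S YS] orth
    by (intro uncorrelated_imp_joint_law_eq_product[OF S XS]) auto
  have ind: "indep_var borel (\<lambda>\<omega>. \<bar>X \<omega>\<bar> powr (-1/2)) borel (\<lambda>\<omega>. \<bar>Y \<omega>\<bar> powr (-1/2))"
    by (rule indep_var_compose_if_joint_law_eq_product[OF _ _ _ _ joint]) measurable
  have int: "integrable M (\<lambda>\<omega>. \<bar>X \<omega>\<bar> powr (-1/2) * \<bar>Y \<omega>\<bar> powr (-1/2))"
    using not0[OF Xnz] not0[OF Ynz] XS YS
    by (intro indep_var_integrable[OF ind] integrable_inverse_sqrt_normal gaussian_space_centred_normal[OF S])
  define K where "K = sqrt (3 + 2 * c\<^sup>2)"
  have "integrable M (\<lambda>\<omega>. K * (\<bar>X \<omega>\<bar> powr (-1/2) * \<bar>Y \<omega>\<bar> powr (-1/2)))"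
    using int by (rule integrable_mult_right)
  then show ?thesis
  proof (rule Bochner_Integration.integrable_bound)
    show "AE \<omega> in M. norm (1 / norm (V \<omega>)) \<le> norm (K * (\<bar>X \<omega>\<bar> powr (-1/2) * \<bar>Y \<omega>\<bar> powr (-1/2)))"
      using Xnz Ynz
    proof eventually_elim
      fix \<omega> assume XY: "X \<omega> \<noteq> 0" "Y \<omega> \<noteq> 0"
      let ?x = "X \<omega>" and ?y = "Y \<omega>" and ?n = "norm (V \<omega>)"
      have n0: "?n > 0" using XY by (auto simp: X_def)
      have b: "\<bar>?x\<bar> \<le> ?n" "\<bar>V \<omega> $ j\<bar> \<le> ?n"
        unfolding X_def by (rule component_le_norm_cart)+
      have sq: "?x\<^sup>2 \<le> ?n\<^sup>2" "(V \<omega> $ j)\<^sup>2 \<le> ?n\<^sup>2"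
        using b by (simp_all add: abs_le_square_iff[symmetric])
      have am: "2 * (\<bar>?x\<bar> * \<bar>?y\<bar>) \<le> ?x\<^sup>2 + ?y\<^sup>2"
        using zero_le_power2[of "\<bar>?x\<bar> - \<bar>?y\<bar>"] by (simp add: power2_diff)
      have y2: "?y\<^sup>2 \<le> 2 * (V \<omega> $ j)\<^sup>2 + 2 * c\<^sup>2 * ?x\<^sup>2"
        using zero_le_power2[of "V \<omega> $ j + c * ?x"]
        by (simp add: Y_def power2_diff power2_sum power_mult_distrib)
      have cn: "c\<^sup>2 * ?x\<^sup>2 \<le> c\<^sup>2 * ?n\<^sup>2" using sq by (intro mult_left_mono) auto
      have "\<bar>?x\<bar> * \<bar>?y\<bar> \<le> (3 + 2 * c\<^sup>2) * ?n\<^sup>2"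
      proof -
        have "(3 + 2 * c\<^sup>2) * ?n\<^sup>2 = 3 * ?n\<^sup>2 + 2 * (c\<^sup>2 * ?n\<^sup>2)" by (simp add: algebra_simps)
        moreover have "0 \<le> \<bar>?x\<bar> * \<bar>?y\<bar>" by simp
        ultimately show ?thesis
          using am y2 sq cn by (simp only: mult.assoc)
      qed
      then have "sqrt (\<bar>?x\<bar> * \<bar>?y\<bar>) \<le> K * ?n"
        using real_sqrt_le_mono by (fastforce simp: K_def real_sqrt_mult)
      moreover have xy0: "sqrt (\<bar>?x\<bar> * \<bar>?y\<bar>) > 0" using XY by simp
      ultimately have "1 / ?n \<le> K / sqrt (\<bar>?x\<bar> * \<bar>?y\<bar>)"
        using n0 by (simp add: field_simps)
      also have "\<dots> = K * (\<bar>?x\<bar> powr (-1/2) * \<bar>?y\<bar> powr (-1/2))"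
        using XY by (simp add: powr_minus_divide powr_half_sqrt real_sqrt_mult)
      finally show "norm (1 / ?n) \<le> norm (K * (\<bar>?x\<bar> powr (-1/2) * \<bar>?y\<bar> powr (-1/2)))"
        using n0 by simp
    qed
  qed measurable
qed

text \<open>Gaussian integration by parts for the vector field \<open>v \<mapsto> v / norm v\<close>. It is applied to the bounded smooth
  field \<open>v / sqrt (v \<bullet> v + e)\<close>, whose Jacobian matrix has rows of norm at most \<open>2 / norm v\<close>; as \<open>e\<close> tends to \<open>0\<close>,
  dominated convergence applies since \<open>1 / norm V\<close> is integrable.\<close>

lemma expectation_sq_component_div_norm:
  fixes V :: "'a \<Rightarrow> real^'n"
  assumes S: "gaussian_space M S" and V: "\<And>v. (\<lambda>\<omega>. v \<bullet> V \<omega>) \<in> S"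
    and nz: "AE \<omega> in M. V \<omega> \<noteq> 0" and inv: "integrable M (\<lambda>\<omega>. 1 / norm (V \<omega>))"
    and normint: "integrable M (\<lambda>\<omega>. norm (V \<omega>))"
  shows "expectation (\<lambda>\<omega>. (V \<omega> $ i)\<^sup>2 / norm (V \<omega>)) =
      (\<Sum>j\<in>UNIV. expectation (\<lambda>\<omega>. V \<omega> $ i * V \<omega> $ j) * expectation (\<lambda>\<omega>. unit_jac i j (V \<omega>)))"
proof -
  have [measurable]: "V \<in> borel_measurable M"
    by (rule gaussian_space_vector_measurable[OF S V])
  have comp: "(\<lambda>\<omega>. V \<omega> $ k) \<in> S" for k
    using V[of "axis k 1"] by (simp add: inner_axis')
  note [measurable] = gaussian_space_measurable[OF S comp]
  define m where "m = (\<chi> j. expectation (\<lambda>\<omega>. V \<omega> $ i * V \<omega> $ j))"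
  have m: "expectation (\<lambda>\<omega>. V \<omega> $ i * (v \<bullet> V \<omega>)) = v \<bullet> m" for v
  proof -
    have "expectation (\<lambda>\<omega>. V \<omega> $ i * (v \<bullet> V \<omega>)) = expectation (\<lambda>\<omega>. \<Sum>j\<in>UNIV. v $ j * (V \<omega> $ i * V \<omega> $ j))"
      by (simp add: inner_vec_def sum_distrib_left mult_ac)
    also have "\<dots> = (\<Sum>j\<in>UNIV. expectation (\<lambda>\<omega>. v $ j * (V \<omega> $ i * V \<omega> $ j)))"
      using gaussian_space_integrable_mult[OF S comp comp] by (intro Bochner_Integration.integral_sum) simp
    finally show ?thesis by (simp add: inner_vec_def m_def)
  qed
  define s where "s e v = sqrt (v \<bullet> v + e)" for e and v :: "real^'n"
  define D where "D e v = (1 / s e v) *\<^sub>R axis i 1 - (v $ i / s e v ^ 3) *\<^sub>R v" for e and v :: "real^'n"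
  have s_pos: "s e v > 0" "norm v \<le> s e v" "sqrt e \<le> s e v" if "e > 0" for e v
    using that by (auto simp: s_def norm_eq_sqrt_inner add_nonneg_pos)
  have s_cont: "continuous_on UNIV (s e)" for e
    unfolding s_def by (intro continuous_intros)
  have D_le: "norm (D e v) \<le> 2 / s e v" if "e > 0" for e v
  proof -
    have "norm ((v $ i / s e v ^ 3) *\<^sub>R v) = (\<bar>v $ i\<bar> * norm v) / s e v ^ 3"
      using s_pos[OF that, of v] by simp
    also have "\<dots> \<le> (s e v * s e v) / s e v ^ 3"
      using s_pos[OF that, of v] component_le_norm_cart[of v i]
      by (intro divide_right_mono mult_mono) auto
    also have "\<dots> = 1 / s e v" using s_pos[OF that, of v] by (simp add: power3_eq_cube)
    finally have "norm ((v $ i / s e v ^ 3) *\<^sub>R v) \<le> 1 / s e v" .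
    moreover have "norm ((1 / s e v) *\<^sub>R (axis i 1 :: real^'n)) = 1 / s e v"
      using s_pos[OF that, of v] by simp
    ultimately show ?thesis
      unfolding D_def using norm_triangle_ineq4[of "(1 / s e v) *\<^sub>R (axis i 1 :: real^'n)" "(v $ i / s e v ^ 3) *\<^sub>R v"]
      by linarith
  qed
  have stein: "expectation (\<lambda>\<omega>. V \<omega> $ i * (V \<omega> $ i / s e (V \<omega>))) = expectation (\<lambda>\<omega>. m \<bullet> D e (V \<omega>))" if e: "e > 0" for e
  proof (rule stein_gaussian_space[OF S comp V m, where B="1 + 2 / sqrt e" and F = "\<lambda>v. v $ i / s e v"])
    fix v
    have "GDERIV (s e) v :> (1 / s e v) *\<^sub>R v"
      unfolding gderiv_def s_def using s_pos[OF e, of v]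
      by (auto intro!: derivative_eq_intros simp: s_def inner_commute field_simps)
    moreover have "GDERIV (\<lambda>v. v $ i) v :> axis i 1"
      using bounded_linear.has_derivative[OF bounded_linear_vec_nth has_derivative_ident, of i]
      by (simp add: gderiv_def inner_axis)
    ultimately have "GDERIV (\<lambda>v. v $ i * inverse (s e v)) v :>
        (v $ i) *\<^sub>R (- (inverse (s e v))\<^sup>2 *\<^sub>R ((1 / s e v) *\<^sub>R v)) + inverse (s e v) *\<^sub>R axis i 1"
      using s_pos[OF e, of v] by (intro GDERIV_mult GDERIV_inverse) auto
    also have "(v $ i) *\<^sub>R (- (inverse (s e v))\<^sup>2 *\<^sub>R ((1 / s e v) *\<^sub>R v)) + inverse (s e v) *\<^sub>R axis i 1 = D e v"
      by (simp add: D_def field_simps power2_eq_square power3_eq_cube)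
    finally show "GDERIV (\<lambda>v. v $ i / s e v) v :> D e v"
      by (simp add: divide_inverse)
    have "\<bar>v $ i / s e v\<bar> \<le> 1"
      using s_pos[OF e, of v] component_le_norm_cart[of v i] by (simp add: divide_le_eq)
    then show "\<bar>v $ i / s e v\<bar> \<le> 1 + 2 / sqrt e" using e by (simp add: add_increasing2)
    have "2 / s e v \<le> 2 / sqrt e"
      using s_pos[OF e, of v] e by (intro divide_left_mono) auto
    then show "norm (D e v) \<le> 1 + 2 / sqrt e" using D_le[OF e, of v] by simp
  next
    show "continuous_on UNIV (D e)"
      unfolding D_def using s_pos[OF e] by (intro continuous_intros s_cont) (auto simp: less_imp_neq[symmetric])
  qed
  define e where "e n = 1 / real (Suc n)" for n
  have e: "e n > 0" for n by (simp add: e_def)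
  have e0: "e \<longlonglongrightarrow> 0" unfolding e_def by (rule LIMSEQ_Suc[OF lim_const_over_n[of 1]])
  have s_lim: "(\<lambda>n. s (e n) v) \<longlonglongrightarrow> norm v" for v
  proof -
    have "(\<lambda>n. s (e n) v) \<longlonglongrightarrow> sqrt (v \<bullet> v + 0)" unfolding s_def by (intro tendsto_intros e0)
    then show ?thesis by (simp add: norm_eq_sqrt_inner)
  qed
  have [measurable]: "s e \<in> borel_measurable borel" for e
    using s_cont by (rule borel_measurable_continuous_onI)
  have [measurable]: "D e \<in> borel_measurable borel" for e unfolding D_def by measurable
  have L: "(\<lambda>n. expectation (\<lambda>\<omega>. V \<omega> $ i * (V \<omega> $ i / s (e n) (V \<omega>)))) \<longlonglongrightarrow> expectation (\<lambda>\<omega>. (V \<omega> $ i)\<^sup>2 / norm (V \<omega>))"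
  proof (rule integral_dominated_convergence[OF _ _ normint])
    show "AE \<omega> in M. (\<lambda>n. V \<omega> $ i * (V \<omega> $ i / s (e n) (V \<omega>))) \<longlonglongrightarrow> (V \<omega> $ i)\<^sup>2 / norm (V \<omega>)"
      using nz
    proof eventually_elim
      fix \<omega> assume "V \<omega> \<noteq> 0"
      then have "(\<lambda>n. V \<omega> $ i * (V \<omega> $ i / s (e n) (V \<omega>))) \<longlonglongrightarrow> V \<omega> $ i * (V \<omega> $ i / norm (V \<omega>))"
        by (intro tendsto_intros s_lim) auto
      then show "(\<lambda>n. V \<omega> $ i * (V \<omega> $ i / s (e n) (V \<omega>))) \<longlonglongrightarrow> (V \<omega> $ i)\<^sup>2 / norm (V \<omega>)"
        by (simp add: power2_eq_square)
    qed
    have "norm (v $ i * (v $ i / s (e n) v)) \<le> norm v" for n v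
    proof -
      have "\<bar>v $ i\<bar> * (\<bar>v $ i\<bar> / s (e n) v) \<le> norm v * 1"
        using s_pos[OF e[of n], of v] component_le_norm_cart[of v i]
        by (intro mult_mono) (auto simp: divide_le_eq)
      then show ?thesis using s_pos[OF e[of n], of v] by (simp add: abs_mult)
    qed
    then show "AE \<omega> in M. norm (V \<omega> $ i * (V \<omega> $ i / s (e n) (V \<omega>))) \<le> norm (V \<omega>)" for n by simp
  qed measurable
  have R: "(\<lambda>n. expectation (\<lambda>\<omega>. m \<bullet> D (e n) (V \<omega>))) \<longlonglongrightarrow> expectation (\<lambda>\<omega>. \<Sum>j\<in>UNIV. m $ j * unit_jac i j (V \<omega>))"
  proof (rule integral_dominated_convergence)
    show "integrable M (\<lambda>\<omega>. norm m * (2 * (1 / norm (V \<omega>))))"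
      using inv by (intro integrable_mult_right)
    show "AE \<omega> in M. (\<lambda>n. m \<bullet> D (e n) (V \<omega>)) \<longlonglongrightarrow> (\<Sum>j\<in>UNIV. m $ j * unit_jac i j (V \<omega>))"
      using nz
    proof eventually_elim
      fix \<omega> assume nz: "V \<omega> \<noteq> 0"
      then have "(\<lambda>n. m \<bullet> D (e n) (V \<omega>)) \<longlonglongrightarrow> m \<bullet> ((1 / norm (V \<omega>)) *\<^sub>R axis i 1 - (V \<omega> $ i / norm (V \<omega>) ^ 3) *\<^sub>R V \<omega>)"
        unfolding D_def by (intro tendsto_intros s_lim) auto
      also have "m \<bullet> ((1 / norm (V \<omega>)) *\<^sub>R axis i 1 - (V \<omega> $ i / norm (V \<omega>) ^ 3) *\<^sub>R V \<omega>) = (\<Sum>j\<in>UNIV. m $ j * unit_jac i j (V \<omega>))"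
        unfolding inner_vec_def by (intro sum.cong) (auto simp: unit_jac_def axis_def)
      finally show "(\<lambda>n. m \<bullet> D (e n) (V \<omega>)) \<longlonglongrightarrow> (\<Sum>j\<in>UNIV. m $ j * unit_jac i j (V \<omega>))" .
    qed
    show "AE \<omega> in M. norm (m \<bullet> D (e n) (V \<omega>)) \<le> norm m * (2 * (1 / norm (V \<omega>)))" for n
      using nz
    proof eventually_elim
      fix \<omega> assume nz: "V \<omega> \<noteq> 0"
      have "norm (m \<bullet> D (e n) (V \<omega>)) \<le> norm m * norm (D (e n) (V \<omega>))"
        by (simp add: Cauchy_Schwarz_ineq2)
      also have "\<dots> \<le> norm m * (2 / s (e n) (V \<omega>))"
        by (intro mult_left_mono D_le e) simp
      also have "\<dots> \<le> norm m * (2 / norm (V \<omega>))"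
        using s_pos[OF e[of n], of "V \<omega>"] nz by (intro mult_left_mono divide_left_mono) auto
      finally show "norm (m \<bullet> D (e n) (V \<omega>)) \<le> norm m * (2 * (1 / norm (V \<omega>)))" by simp
    qed
  qed measurable
  have "expectation (\<lambda>\<omega>. (V \<omega> $ i)\<^sup>2 / norm (V \<omega>)) = expectation (\<lambda>\<omega>. \<Sum>j\<in>UNIV. m $ j * unit_jac i j (V \<omega>))"
    using L R stein[OF e] by (simp add: LIMSEQ_unique)
  also have "\<dots> = (\<Sum>j\<in>UNIV. expectation (\<lambda>\<omega>. m $ j * unit_jac i j (V \<omega>)))"
  proof (intro Bochner_Integration.integral_sum integrable_mult_right)
    fix j
    show "integrable M (\<lambda>\<omega>. unit_jac i j (V \<omega>))"
      by (rule Bochner_Integration.integrable_bound[OF integrable_mult_right[OF inv, of 2]])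
         (use abs_unit_jac_le in auto)
  qed
  finally show ?thesis by (simp add: m_def)
qed

text \<open>Summing over the components, \<open>norm V\<close> being the inner product of \<open>V\<close> with \<open>V / norm V\<close>.\<close>

lemma expectation_norm_gaussian:
  fixes V :: "'a \<Rightarrow> real^'n"
  assumes S: "gaussian_space M S" and V: "\<And>v. (\<lambda>\<omega>. v \<bullet> V \<omega>) \<in> S"
    and nz: "AE \<omega> in M. V \<omega> \<noteq> 0" and inv: "integrable M (\<lambda>\<omega>. 1 / norm (V \<omega>))"
  shows "integrable M (\<lambda>\<omega>. norm (V \<omega>))"
    and "expectation (\<lambda>\<omega>. norm (V \<omega>)) =
      (\<Sum>i\<in>UNIV. \<Sum>j\<in>UNIV. expectation (\<lambda>\<omega>. V \<omega> $ i * V \<omega> $ j) * expectation (\<lambda>\<omega>. unit_jac i j (V \<omega>)))"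
proof -
  have [measurable]: "V \<in> borel_measurable M"
    by (rule gaussian_space_vector_measurable[OF S V])
  have comp: "(\<lambda>\<omega>. V \<omega> $ k) \<in> S" for k
    using V[of "axis k 1"] by (simp add: inner_axis')
  note [measurable] = gaussian_space_measurable[OF S comp]
  have "integrable M (\<lambda>\<omega>. \<Sum>i\<in>UNIV. \<bar>V \<omega> $ i\<bar>)"
    using centred_normal_integrable[OF gaussian_space_centred_normal[OF S comp]] by auto
  then show normint: "integrable M (\<lambda>\<omega>. norm (V \<omega>))"
    by (rule Bochner_Integration.integrable_bound) (use norm_le_l1_cart in \<open>auto simp: sum_nonneg\<close>)
  have "expectation (\<lambda>\<omega>. norm (V \<omega>)) = expectation (\<lambda>\<omega>. \<Sum>i\<in>UNIV. (V \<omega> $ i)\<^sup>2 / norm (V \<omega>))"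
  proof (intro Bochner_Integration.integral_cong refl)
    fix \<omega>
    have "(\<Sum>i\<in>UNIV. (V \<omega> $ i)\<^sup>2 / norm (V \<omega>)) = (V \<omega> \<bullet> V \<omega>) / norm (V \<omega>)"
      by (simp add: inner_vec_def power2_eq_square flip: sum_divide_distrib)
    then show "norm (V \<omega>) = (\<Sum>i\<in>UNIV. (V \<omega> $ i)\<^sup>2 / norm (V \<omega>))"
      by (simp add: power2_norm_eq_inner[symmetric] power2_eq_square)
  qed
  also have "\<dots> = (\<Sum>i\<in>UNIV. expectation (\<lambda>\<omega>. (V \<omega> $ i)\<^sup>2 / norm (V \<omega>)))"
  proof (intro Bochner_Integration.integral_sum)
    fix i
    have "norm ((v $ i)\<^sup>2 / norm v) \<le> norm (norm v)" for v :: "real^'n"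
    proof -
      have "(v $ i)\<^sup>2 \<le> norm v * norm v"
        using component_le_norm_cart[of v i] by (simp add: abs_le_square_iff[symmetric] flip: power2_eq_square)
      then show ?thesis by (cases "v = 0") (simp_all add: divide_le_eq)
    qed
    note le = this
    show "integrable M (\<lambda>\<omega>. (V \<omega> $ i)\<^sup>2 / norm (V \<omega>))"
      by (rule Bochner_Integration.integrable_bound[OF normint]) (measurable, use le in simp)
  qed
  also have "\<dots> = (\<Sum>i\<in>UNIV. \<Sum>j\<in>UNIV. expectation (\<lambda>\<omega>. V \<omega> $ i * V \<omega> $ j) * expectation (\<lambda>\<omega>. unit_jac i j (V \<omega>)))"
    by (intro sum.cong refl expectation_sq_component_div_norm[OF S V nz inv normint])
  finally show "expectation (\<lambda>\<omega>. norm (V \<omega>)) = \<dots>" .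
qed

end

section \<open>The curvature of level sets\<close>

lemma GDERIV_gradient:
  fixes g :: "real^'n \<Rightarrow> real"
  assumes "g differentiable (at x)"
  shows "GDERIV g x :> gradient g x"
proof -
  obtain g' where g': "(g has_derivative g') (at x)"
    using assms by (auto simp: differentiable_def)
  then have lin: "linear g'" by (rule has_derivative_linear)
  define D where "D = (\<Sum>b\<in>Basis. g' b *\<^sub>R b)"
  have "g' h = h \<bullet> D" for h
  proof -
    have "g' h = g' (\<Sum>b\<in>Basis. (h \<bullet> b) *\<^sub>R b)" by (simp add: euclidean_representation)
    also have "\<dots> = (\<Sum>b\<in>Basis. (h \<bullet> b) * g' b)"
      by (simp add: linear_sum[OF lin] linear_scale[OF lin])
    also have "\<dots> = h \<bullet> D" by (simp add: D_def inner_sum_right mult.commute)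
    finally show ?thesis .
  qed
  then have "g' = (\<lambda>h. h \<bullet> D)" by blast
  with g' have D: "GDERIV g x :> D" by (simp add: gderiv_def)
  have "D' = D" if "GDERIV g x :> D'" for D'
  proof -
    have "(\<lambda>h. h \<bullet> D') = (\<lambda>h. h \<bullet> D)"
      using that D unfolding gderiv_def by (rule has_derivative_unique)
    then have "(D' - D) \<bullet> D' = (D' - D) \<bullet> D" by (rule fun_cong)
    then have "(D' - D) \<bullet> (D' - D) = 0" by (simp add: inner_diff_right)
    then show ?thesis by simp
  qed
  with D have "gradient g x = D" unfolding gradient_def by (rule the_equality)
  with D show ?thesis by simp
qed

lemma has_derivative_difference_quotients:
  fixes F :: "'a::real_normed_vector \<Rightarrow> real"
  assumes F: "(F has_derivative F') (at x)"
  shows "(\<lambda>n. real (Suc n) * (F (x + (1 / real (Suc n)) *\<^sub>R v) - F x)) \<longlonglongrightarrow> F' v"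
proof -
  have "((\<lambda>t. F (x + t *\<^sub>R v)) has_derivative (\<lambda>t. F' (t *\<^sub>R v))) (at 0)"
    by (rule has_derivative_compose[where f="\<lambda>t. x + t *\<^sub>R v" and g=F])
       (auto intro!: derivative_eq_intros simp: F)
  moreover have "(\<lambda>t. F' (t *\<^sub>R v)) = (*) (F' v)"
    using linear_scale[OF has_derivative_linear[OF F]] by (auto simp: fun_eq_iff)
  ultimately have "((\<lambda>t. F (x + t *\<^sub>R v)) has_field_derivative F' v) (at 0)"
    by (simp add: has_field_derivative_def)
  then have "((\<lambda>t. (F (x + t *\<^sub>R v) - F x) / t) \<longlongrightarrow> F' v) (at 0)"
    by (simp add: has_field_derivative_iff)
  moreover have "filterlim (\<lambda>n. 1 / real (Suc n)) (at 0) sequentially"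
    by (rule filterlim_atI[OF LIMSEQ_Suc[OF lim_const_over_n[of 1]]]) auto
  ultimately have "(\<lambda>n. (F (x + (1 / real (Suc n)) *\<^sub>R v) - F x) / (1 / real (Suc n))) \<longlonglongrightarrow> F' v"
    by (rule filterlim_compose)
  then show ?thesis by (simp add: mult.commute)
qed

lemma has_derivative_backward_difference_quotients:
  fixes F :: "'a::real_normed_vector \<Rightarrow> real"
  assumes F: "(F has_derivative F') (at x)"
  shows "(\<lambda>n. real (Suc n) * (F x - F (x - (1 / real (Suc n)) *\<^sub>R v))) \<longlonglongrightarrow> F' v"
  using tendsto_minus[OF has_derivative_difference_quotients[OF F, of "- v"]]
    linear_neg[OF has_derivative_linear[OF F], of v]
  by (simp add: algebra_simps)

lemma has_derivative_central_difference_quotients: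
  fixes F :: "'a::real_normed_vector \<Rightarrow> real"
  assumes F: "(F has_derivative F') (at x)"
  shows "(\<lambda>n. real (Suc n) / 2 * (F (x + (1 / real (Suc n)) *\<^sub>R v) - F (x - (1 / real (Suc n)) *\<^sub>R v))) \<longlonglongrightarrow> F' v"
proof -
  have "(\<lambda>n. (real (Suc n) * (F (x + (1 / real (Suc n)) *\<^sub>R v) - F x)
      + real (Suc n) * (F x - F (x - (1 / real (Suc n)) *\<^sub>R v))) / 2) \<longlonglongrightarrow> (F' v + F' v) / 2"
    by (intro tendsto_intros has_derivative_difference_quotients[OF F]
        has_derivative_backward_difference_quotients[OF F]) simp
  then show ?thesis
    by (simp add: right_diff_distrib diff_divide_distrib add_divide_distrib del: of_nat_Suc)
qed

lemma C2_smooth_has_derivative: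
  assumes "C2_smooth g"
  shows "(g has_derivative (\<lambda>h. h \<bullet> gradient g x)) (at x)"
    and "(gradient g has_derivative (\<lambda>h. hessian g x *v h)) (at x)"
    and "((\<lambda>y. gradient g y $ i) has_derivative (\<lambda>h. (hessian g x *v h) $ i)) (at x)"
proof -
  show "(g has_derivative (\<lambda>h. h \<bullet> gradient g x)) (at x)"
    using assms GDERIV_gradient[of g x] by (simp add: C2_smooth_def gderiv_def)
  show H: "(gradient g has_derivative (\<lambda>h. hessian g x *v h)) (at x)"
    using assms jacobian_works[of "gradient g" "at x"] by (simp add: C2_smooth_def hessian_def)
  show "((\<lambda>y. gradient g y $ i) has_derivative (\<lambda>h. (hessian g x *v h) $ i)) (at x)"
    by (rule bounded_linear.has_derivative[OF bounded_linear_vec_nth H])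
qed

lemma matrix_vector_mult_axis_component: "((A::real^'n^'m) *v axis j 1) $ i = A $ i $ j"
  by (simp add: matrix_vector_mult_basis column_def)

lemma has_derivative_normalize:
  fixes v :: "real^'n"
  assumes "v \<noteq> 0"
  shows "((\<lambda>v. v /\<^sub>R norm v) has_derivative (\<lambda>h. \<chi> i. \<Sum>j\<in>UNIV. unit_jac i j v * h $ j)) (at v)"
proof -
  have "((\<lambda>v. v /\<^sub>R norm v) has_derivative
      (\<lambda>h. inverse (norm v) *\<^sub>R h + (- (inverse (norm v) * (sgn v \<bullet> h) * inverse (norm v))) *\<^sub>R v)) (at v)"
    using assms GDERIV_norm[OF assms, unfolded gderiv_def]
    by (auto intro!: derivative_eq_intros simp: inner_commute)
  moreover have "inverse (norm v) *\<^sub>R h + (- (inverse (norm v) * (sgn v \<bullet> h) * inverse (norm v))) *\<^sub>R v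
      = (\<chi> i. \<Sum>j\<in>UNIV. unit_jac i j v * h $ j)" for h
  proof (rule vec_eq_iff[THEN iffD2], rule allI)
    fix i
    have "(\<Sum>j\<in>UNIV. unit_jac i j v * h $ j) =
        (\<Sum>j\<in>UNIV. (if i = j then h $ j / norm v else 0)) - (\<Sum>j\<in>UNIV. v $ i * (v $ j * h $ j) / norm v ^ 3)"
      unfolding sum_subtractf[symmetric]
      by (intro sum.cong) (auto simp: unit_jac_def algebra_simps)
    also have "\<dots> = h $ i / norm v - v $ i * (v \<bullet> h) / norm v ^ 3"
      by (simp add: inner_vec_def sum_distrib_left sum_divide_distrib)
    also have "\<dots> = (inverse (norm v) *\<^sub>R h + (- (inverse (norm v) * (sgn v \<bullet> h) * inverse (norm v))) *\<^sub>R v) $ i"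
      by (simp add: sgn_div_norm divide_inverse power3_eq_cube)
    finally show "(inverse (norm v) *\<^sub>R h + (- (inverse (norm v) * (sgn v \<bullet> h) * inverse (norm v))) *\<^sub>R v) $ i
      = (\<chi> i. \<Sum>j\<in>UNIV. unit_jac i j v * h $ j) $ i" by simp
  qed
  ultimately show ?thesis by simp
qed

text \<open>The chain rule for the composition of the gradient with \<open>v \<mapsto> v / norm v\<close>.\<close>

lemma level_curvature_eq:
  assumes "C2_smooth g" and nz: "gradient g x \<noteq> 0"
  shows "level_curvature g x = (\<Sum>i\<in>UNIV. \<Sum>j\<in>UNIV. unit_jac i j (gradient g x) * hessian g x $ j $ i)"
proof -
  let ?F = "\<lambda>y. gradient g y /\<^sub>R norm (gradient g y)"
  let ?F' = "\<lambda>h. \<chi> i. \<Sum>j\<in>UNIV. unit_jac i j (gradient g x) * (hessian g x *v h) $ j"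
  have "(?F has_derivative ?F') (at x)"
    by (rule has_derivative_compose[OF C2_smooth_has_derivative(2)[OF assms(1)] has_derivative_normalize[OF nz]])
  then have "frechet_derivative ?F (at x) = ?F'"
    by (rule frechet_derivative_at[symmetric])
  then show ?thesis
    by (simp add: level_curvature_def divergence_def jacobian_def trace_def matrix_def matrix_vector_mult_axis_component)
qed

section \<open>Regression for Gaussian value, gradient and Hessian\<close>

context prob_space begin

text \<open>The regression computation for an abstract Gaussian triple with the covariances of value, gradient and
  Hessian of a stationary field. The remainder \<open>R = H + L * X\<close>, with \<open>L\<close> the covariance
  matrix of \<open>V\<close>, is uncorrelated with the pair of \<open>X\<close> and \<open>V\<close>, hence independent of it, so that
  its product with an integrable function of the pair has mean zero. The part \<open>- L * X\<close> contributes
  minus the mean of \<open>indicator B X * X\<close> times that of \<open>\<Sum>i j. L i j * unit_jac i j V\<close>, since \<open>X\<close> and \<open>V\<close> are independent,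
  and the latter is the mean of \<open>norm V\<close>.\<close>

lemma gaussian_curvature_regression:
  fixes V :: "'a \<Rightarrow> real^'n" and H :: "'n \<Rightarrow> 'n \<Rightarrow> 'a \<Rightarrow> real"
  assumes S: "gaussian_space M S" and X: "X \<in> S" and V: "\<And>v. (\<lambda>\<omega>. v \<bullet> V \<omega>) \<in> S" and H: "\<And>i j. H i j \<in> S"
    and XX: "expectation (\<lambda>\<omega>. X \<omega> * X \<omega>) = 1"
    and XV: "\<And>i. expectation (\<lambda>\<omega>. X \<omega> * V \<omega> $ i) = 0"
    and HV: "\<And>i j k. expectation (\<lambda>\<omega>. H i j \<omega> * V \<omega> $ k) = 0"
    and HX: "\<And>i j. expectation (\<lambda>\<omega>. H i j \<omega> * X \<omega>) = - expectation (\<lambda>\<omega>. V \<omega> $ i * V \<omega> $ j)"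
    and nz: "\<And>v. v \<noteq> 0 \<Longrightarrow> AE \<omega> in M. v \<bullet> V \<omega> \<noteq> 0" and card: "CARD('n) \<ge> 2"
    and B[measurable]: "B \<in> sets borel"
  defines "Y \<equiv> \<lambda>\<omega>. \<Sum>i\<in>UNIV. \<Sum>j\<in>UNIV. unit_jac i j (V \<omega>) * H j i \<omega>"
  shows "integrable M (\<lambda>\<omega>. norm (V \<omega>))" and "integrable M Y"
    and "expectation (\<lambda>\<omega>. indicator B (X \<omega>) * Y \<omega>) =
      - expectation (\<lambda>\<omega>. norm (V \<omega>)) * expectation (\<lambda>\<omega>. indicator B (X \<omega>) * X \<omega>)"
proof -
  have comp: "(\<lambda>\<omega>. V \<omega> $ k) \<in> S" for k
    using V[of "axis k 1"] by (simp add: inner_axis')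
  have [measurable]: "V \<in> borel_measurable M"
    by (rule gaussian_space_vector_measurable[OF S V])
  note [measurable] = gaussian_space_measurable[OF S X] gaussian_space_measurable[OF S H]
  note mint = gaussian_space_integrable_mult[OF S]
  obtain i0 :: 'n where True by auto
  have "AE \<omega> in M. axis i0 1 \<bullet> V \<omega> \<noteq> 0"
    by (rule nz) (simp add: axis_eq_0_iff)
  then have Vnz: "AE \<omega> in M. V \<omega> \<noteq> 0"
    by eventually_elim auto
  have inv: "integrable M (\<lambda>\<omega>. 1 / norm (V \<omega>))"
    by (rule integrable_inverse_norm_gaussian[OF S V nz card])
  show "integrable M (\<lambda>\<omega>. norm (V \<omega>))"
    by (rule expectation_norm_gaussian(1)[OF S V Vnz inv])
  define L where "L i j = expectation (\<lambda>\<omega>. V \<omega> $ i * V \<omega> $ j)" for i j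
  have L_sym: "L i j = L j i" for i j by (simp add: L_def mult.commute)
  have uj: "integrable M (\<lambda>\<omega>. unit_jac i j (V \<omega>))" for i j
    by (rule Bochner_Integration.integrable_bound[OF integrable_mult_right[OF inv, of 2]])
       (use abs_unit_jac_le in auto)
  have sumV: "expectation (\<lambda>\<omega>. Z \<omega> * (v \<bullet> V \<omega>)) = (\<Sum>k\<in>UNIV. v $ k * expectation (\<lambda>\<omega>. Z \<omega> * V \<omega> $ k))"
    if "Z \<in> S" for Z v
  proof -
    have "expectation (\<lambda>\<omega>. Z \<omega> * (v \<bullet> V \<omega>)) = expectation (\<lambda>\<omega>. \<Sum>k\<in>UNIV. v $ k * (Z \<omega> * V \<omega> $ k))"
      by (simp add: inner_vec_def sum_distrib_left mult_ac)
    also have "\<dots> = (\<Sum>k\<in>UNIV. expectation (\<lambda>\<omega>. v $ k * (Z \<omega> * V \<omega> $ k)))"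
      using mint[OF that comp] by (intro Bochner_Integration.integral_sum) simp
    finally show ?thesis by simp
  qed
  have XV_joint: "distr M borel X \<Otimes>\<^sub>M distr M borel V = distr M borel (\<lambda>\<omega>. (X \<omega>, V \<omega>))"
    by (rule uncorrelated_imp_joint_law_eq_product[OF S X V]) (simp add: sumV[OF X] XV)
  define R where "R i j \<omega> = H i j \<omega> + L i j * X \<omega>" for i j \<omega>
  have RS: "R i j \<in> S" for i j
    using gaussian_space_lincomb[OF S H X, of 1 i j "L i j"] by (simp add: R_def[abs_def])
  note [measurable] = gaussian_space_measurable[OF S RS]
  have RX: "expectation (\<lambda>\<omega>. R i j \<omega> * X \<omega>) = 0" for i j
  proof -
    have "expectation (\<lambda>\<omega>. R i j \<omega> * X \<omega>) = expectation (\<lambda>\<omega>. H i j \<omega> * X \<omega> + L i j * (X \<omega> * X \<omega>))"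
      by (simp add: R_def algebra_simps)
    also have "\<dots> = expectation (\<lambda>\<omega>. H i j \<omega> * X \<omega>) + L i j * expectation (\<lambda>\<omega>. X \<omega> * X \<omega>)"
      using mint[OF H X] mint[OF X X] by simp
    finally show ?thesis by (simp add: HX XX L_def)
  qed
  have RV: "expectation (\<lambda>\<omega>. R i j \<omega> * V \<omega> $ k) = 0" for i j k
  proof -
    have "expectation (\<lambda>\<omega>. R i j \<omega> * V \<omega> $ k) = expectation (\<lambda>\<omega>. H i j \<omega> * V \<omega> $ k + L i j * (X \<omega> * V \<omega> $ k))"
      by (simp add: R_def algebra_simps)
    also have "\<dots> = expectation (\<lambda>\<omega>. H i j \<omega> * V \<omega> $ k) + L i j * expectation (\<lambda>\<omega>. X \<omega> * V \<omega> $ k)"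
      using mint[OF H comp] mint[OF X comp] by simp
    finally show ?thesis by (simp add: HV XV)
  qed
  have R_joint: "distr M borel (R i j) \<Otimes>\<^sub>M distr M borel (\<lambda>\<omega>. (X \<omega>, V \<omega>)) = distr M borel (\<lambda>\<omega>. (R i j \<omega>, (X \<omega>, V \<omega>)))" for i j
  proof (rule uncorrelated_imp_joint_law_eq_product[OF S RS])
    fix p :: "real \<times> (real^'n)"
    show "(\<lambda>\<omega>. p \<bullet> (X \<omega>, V \<omega>)) \<in> S"
      using gaussian_space_lincomb[OF S X V[of "snd p"], of "fst p" 1] by (simp add: inner_prod_def)
    have "expectation (\<lambda>\<omega>. R i j \<omega> * (p \<bullet> (X \<omega>, V \<omega>))) =
        expectation (\<lambda>\<omega>. fst p * (R i j \<omega> * X \<omega>) + R i j \<omega> * (snd p \<bullet> V \<omega>))"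
      by (simp add: inner_prod_def algebra_simps)
    also have "\<dots> = fst p * expectation (\<lambda>\<omega>. R i j \<omega> * X \<omega>) + expectation (\<lambda>\<omega>. R i j \<omega> * (snd p \<bullet> V \<omega>))"
      using mint[OF RS X] mint[OF RS V] by simp
    also have "\<dots> = 0" by (simp add: RX sumV[OF RS] RV)
    finally show "expectation (\<lambda>\<omega>. R i j \<omega> * (p \<bullet> (X \<omega>, V \<omega>))) = 0" .
  qed
  have term_int: "integrable M (\<lambda>\<omega>. indicator A (X \<omega>) * (unit_jac i j (V \<omega>) * H j i \<omega>))"
    and term_eq: "expectation (\<lambda>\<omega>. indicator A (X \<omega>) * (unit_jac i j (V \<omega>) * H j i \<omega>)) =
      - (L i j * expectation (\<lambda>\<omega>. unit_jac i j (V \<omega>))) * expectation (\<lambda>\<omega>. indicator A (X \<omega>) * X \<omega>)"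
    if A[measurable]: "A \<in> sets borel" for A i j
  proof -
    let ?k = "\<lambda>p::real \<times> (real^'n). indicator A (fst p) * unit_jac i j (snd p) :: real"
    have [measurable]: "?k \<in> borel_measurable borel" by (simp add: borel_prod[symmetric])
    have k_int: "integrable M (\<lambda>\<omega>. ?k (X \<omega>, V \<omega>))"
      by (rule Bochner_Integration.integrable_bound[OF uj[of i j]]) (auto simp: indicator_def)
    have ind1: "indep_var borel (\<lambda>\<omega>. R j i \<omega>) borel (\<lambda>\<omega>. ?k (X \<omega>, V \<omega>))"
      by (rule indep_var_compose_if_joint_law_eq_product[OF _ _ _ _ R_joint, where h = "\<lambda>x. x"])
         (simp_all add: borel_prod[symmetric])
    have R_int: "integrable M (R j i)" and ER: "expectation (R j i) = 0"
      using gaussian_space_centred_normal[OF S RS]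
      by (auto intro: centred_normal_integrable centred_normal_expectation)
    have i1: "integrable M (\<lambda>\<omega>. R j i \<omega> * ?k (X \<omega>, V \<omega>))"
      by (rule indep_var_integrable[OF ind1 R_int k_int])
    have e1: "expectation (\<lambda>\<omega>. R j i \<omega> * ?k (X \<omega>, V \<omega>)) = 0"
      by (subst indep_var_lebesgue_integral[OF ind1 R_int k_int]) (simp add: ER)
    have XA_int: "integrable M (\<lambda>\<omega>. indicator A (X \<omega>) * X \<omega>)"
      by (rule Bochner_Integration.integrable_bound[OF centred_normal_integrable[OF gaussian_space_centred_normal[OF S X]]])
         (auto simp: indicator_def)
    have ind2: "indep_var borel (\<lambda>\<omega>. indicator A (X \<omega>) * X \<omega>) borel (\<lambda>\<omega>. unit_jac i j (V \<omega>))"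
      by (rule indep_var_compose_if_joint_law_eq_product[OF _ _ _ _ XV_joint, where h = "\<lambda>x. indicator A x * x"])
         measurable
    have i2: "integrable M (\<lambda>\<omega>. (indicator A (X \<omega>) * X \<omega>) * unit_jac i j (V \<omega>))"
      by (rule indep_var_integrable[OF ind2 XA_int uj])
    have e2: "expectation (\<lambda>\<omega>. (indicator A (X \<omega>) * X \<omega>) * unit_jac i j (V \<omega>)) =
        expectation (\<lambda>\<omega>. indicator A (X \<omega>) * X \<omega>) * expectation (\<lambda>\<omega>. unit_jac i j (V \<omega>))"
      by (rule indep_var_lebesgue_integral[OF ind2 XA_int uj])
    have eq: "(\<lambda>\<omega>. indicator A (X \<omega>) * (unit_jac i j (V \<omega>) * H j i \<omega>)) =
      (\<lambda>\<omega>. R j i \<omega> * ?k (X \<omega>, V \<omega>) - L j i * ((indicator A (X \<omega>) * X \<omega>) * unit_jac i j (V \<omega>)))"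
      by (simp add: R_def fun_eq_iff algebra_simps)
    show "integrable M (\<lambda>\<omega>. indicator A (X \<omega>) * (unit_jac i j (V \<omega>) * H j i \<omega>))"
      unfolding eq using i1 i2 by (intro Bochner_Integration.integrable_diff integrable_mult_right)
    have "expectation (\<lambda>\<omega>. indicator A (X \<omega>) * (unit_jac i j (V \<omega>) * H j i \<omega>)) =
       expectation (\<lambda>\<omega>. R j i \<omega> * ?k (X \<omega>, V \<omega>)) - L j i * expectation (\<lambda>\<omega>. (indicator A (X \<omega>) * X \<omega>) * unit_jac i j (V \<omega>))"
      unfolding eq by (subst Bochner_Integration.integral_diff[OF i1 integrable_mult_right[OF i2]]) simp
    then show "expectation (\<lambda>\<omega>. indicator A (X \<omega>) * (unit_jac i j (V \<omega>) * H j i \<omega>)) =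
      - (L i j * expectation (\<lambda>\<omega>. unit_jac i j (V \<omega>))) * expectation (\<lambda>\<omega>. indicator A (X \<omega>) * X \<omega>)"
      unfolding e1 e2 by (simp add: L_sym[of j i])
  qed
  show "integrable M Y"
    using term_int[of UNIV] unfolding Y_def by (intro Bochner_Integration.integrable_sum) simp
  have "expectation (\<lambda>\<omega>. indicator B (X \<omega>) * Y \<omega>) =
    expectation (\<lambda>\<omega>. \<Sum>i\<in>UNIV. \<Sum>j\<in>UNIV. indicator B (X \<omega>) * (unit_jac i j (V \<omega>) * H j i \<omega>))"
    unfolding Y_def by (simp add: sum_distrib_left)
  also have "\<dots> = (\<Sum>i\<in>UNIV. \<Sum>j\<in>UNIV. expectation (\<lambda>\<omega>. indicator B (X \<omega>) * (unit_jac i j (V \<omega>) * H j i \<omega>)))"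
    using term_int[OF B]
    by (subst Bochner_Integration.integral_sum; (intro Bochner_Integration.integrable_sum sum.cong Bochner_Integration.integral_sum refl)?)
  also have "\<dots> = - (\<Sum>i\<in>UNIV. \<Sum>j\<in>UNIV. L i j * expectation (\<lambda>\<omega>. unit_jac i j (V \<omega>))) *
      expectation (\<lambda>\<omega>. indicator B (X \<omega>) * X \<omega>)"
    unfolding term_eq[OF B] by (simp add: sum_distrib_right sum_negf)
  also have "(\<Sum>i\<in>UNIV. \<Sum>j\<in>UNIV. L i j * expectation (\<lambda>\<omega>. unit_jac i j (V \<omega>))) = expectation (\<lambda>\<omega>. norm (V \<omega>))"
    unfolding expectation_norm_gaussian(2)[OF S V Vnz inv] L_def ..
  finally show "expectation (\<lambda>\<omega>. indicator B (X \<omega>) * Y \<omega>) =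
      - expectation (\<lambda>\<omega>. norm (V \<omega>)) * expectation (\<lambda>\<omega>. indicator B (X \<omega>) * X \<omega>)" .
qed

end

section \<open>Derivatives of a stationary Gaussian field\<close>

text \<open>Derivatives of the field are limits of difference quotients only almost surely, so their measurability
  rests on completeness of the measure.\<close>

lemma (in complete_measure) borel_measurable_AE_limit:
  fixes X :: "'a \<Rightarrow> real"
  assumes [measurable]: "\<And>n::nat. Y n \<in> borel_measurable M"
    and lim: "AE \<omega> in M. (\<lambda>n. Y n \<omega>) \<longlonglongrightarrow> X \<omega>"
  shows "X \<in> borel_measurable M"
proof (rule measurableI)
  fix A :: "real set" assume [measurable]: "A \<in> sets borel"
  have lim_sets: "(\<lambda>\<omega>. lim (\<lambda>n. Y n \<omega>)) -` A \<inter> space M \<in> sets M"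
    by (rule measurable_sets[where A=borel]) measurable
  have "AE \<omega> in M. \<omega> \<in> (\<lambda>\<omega>. lim (\<lambda>n. Y n \<omega>)) -` A \<inter> space M \<longleftrightarrow> \<omega> \<in> X -` A \<inter> space M"
    using lim by eventually_elim (auto simp: limI)
  then show "X -` A \<inter> space M \<in> sets M"
    by (rule in_sets_AE[OF _ lim_sets]) simp
qed simp

lemma (in complete_measure) ae_limits_complete:
  assumes "gaussian_space M S" and "\<And>n. Y n \<in> S" and "AE \<omega> in M. (\<lambda>n. Y n \<omega>) \<longlonglongrightarrow> X \<omega>"
    and "\<And>n. Y n \<in> A"
  shows "X \<in> ae_limits M A"
proof (rule ae_limitsI[OF _ assms(4,3)])
  show "X \<in> borel_measurable M"
    by (rule borel_measurable_AE_limit[OF gaussian_space_measurable[OF assms(1,2)] assms(3)])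
qed

lemma centred_normal_completion:
  assumes "centred_normal M X" shows "centred_normal (completion M) X"
proof -
  have "distributed (completion M) lborel X d" if X: "distributed M lborel X d" for d
    using X unfolding distributed_def by (simp add: distr_completion measurable_completion)
  then show ?thesis
    using assms unfolding centred_normal_def by (auto intro: measurable_completion AE_completion)
qed

locale smooth_stationary_gaussian_field =
  fixes M :: "'w measure" and f :: "'w \<Rightarrow> real^'n \<Rightarrow> real"
  assumes prob_space_M: "prob_space M"
    and gaussian: "gaussian_field M f"
    and stationary: "stationary_field M f"
    and smooth: "AE \<omega> in M. C2_smooth (f \<omega>)"
begin

sublocale P: prob_space "completion M"
  by (rule prob_space.prob_space_completion[OF prob_space_M])

lemma smooth_completion: "AE \<omega> in completion M. C2_smooth (f \<omega>)"
  using smooth by (rule AE_completion)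

definition field_span :: "('w \<Rightarrow> real) set" where
  "field_span = {\<lambda>\<omega>. \<Sum>y\<in>T. c y * f \<omega> y | T c. finite T}"

abbreviation "deriv_space \<equiv> ae_limits (completion M) field_span"
abbreviation "hessian_space \<equiv> ae_limits (completion M) deriv_space"

lemma gaussian_field_span: "gaussian_space (completion M) field_span"
  unfolding gaussian_space_def
proof (intro conjI ballI allI)
  show "centred_normal (completion M) X" if "X \<in> field_span" for X
    using that gaussian by (auto simp: field_span_def gaussian_field_def intro!: centred_normal_completion)
  fix X Y a b assume "X \<in> field_span" "Y \<in> field_span"
  then obtain T c T' c' where T: "finite T" "finite T'" and XY: "X = (\<lambda>\<omega>. \<Sum>y\<in>T. c y * f \<omega> y)" "Y = (\<lambda>\<omega>. \<Sum>y\<in>T'. c' y * f \<omega> y)"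
    by (auto simp: field_span_def)
  define d where "d y = a * (if y \<in> T then c y else 0) + b * (if y \<in> T' then c' y else 0)" for y
  have "a * X \<omega> + b * Y \<omega> = (\<Sum>y\<in>T \<union> T'. d y * f \<omega> y)" for \<omega>
  proof -
    have "X \<omega> = (\<Sum>y\<in>T \<union> T'. (if y \<in> T then c y else 0) * f \<omega> y)"
      unfolding XY using T by (intro sum.mono_neutral_cong_left) auto
    moreover have "Y \<omega> = (\<Sum>y\<in>T \<union> T'. (if y \<in> T' then c' y else 0) * f \<omega> y)"
      unfolding XY using T by (intro sum.mono_neutral_cong_left) auto
    ultimately show ?thesis
      by (simp add: d_def sum_distrib_left distrib_right sum.distrib mult.assoc)
  qed
  then have "(\<lambda>\<omega>. a * X \<omega> + b * Y \<omega>) = (\<lambda>\<omega>. \<Sum>y\<in>T \<union> T'. d y * f \<omega> y)" by (rule ext)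
  then show "(\<lambda>\<omega>. a * X \<omega> + b * Y \<omega>) \<in> field_span"
    using T by (auto simp: field_span_def)
qed

lemmas gaussian_deriv_space = P.gaussian_space_ae_limits[OF gaussian_field_span]
lemmas gaussian_hessian_space = P.gaussian_space_ae_limits[OF gaussian_deriv_space]
lemmas field_span_subset = subset_ae_limits[OF gaussian_field_span]
lemmas deriv_space_subset = subset_ae_limits[OF gaussian_deriv_space]

lemma field_in_span: "(\<lambda>\<omega>. f \<omega> y) \<in> field_span"
  unfolding field_span_def by (rule CollectI, rule exI[of _ "{y}"], rule exI[of _ "\<lambda>_. 1"]) simp

lemma gradient_in_deriv_space: "(\<lambda>\<omega>. gradient (f \<omega>) y $ i) \<in> deriv_space"
proof (rule completion.ae_limits_complete[OF gaussian_field_span])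
  let ?Y = "\<lambda>n \<omega>. real (Suc n) * (f \<omega> (y + (1 / real (Suc n)) *\<^sub>R axis i 1) - f \<omega> y)"
  show "?Y n \<in> field_span" for n
    by (intro gaussian_space_scale[OF gaussian_field_span] gaussian_space_diff[OF gaussian_field_span] field_in_span)
  then show "?Y n \<in> field_span" for n .
  show "AE \<omega> in completion M. (\<lambda>n. ?Y n \<omega>) \<longlonglongrightarrow> gradient (f \<omega>) y $ i"
    using smooth_completion
  proof eventually_elim
    fix \<omega> assume "C2_smooth (f \<omega>)"
    from has_derivative_difference_quotients[OF C2_smooth_has_derivative(1)[OF this], of y "axis i 1"]
    show "(\<lambda>n. ?Y n \<omega>) \<longlonglongrightarrow> gradient (f \<omega>) y $ i" by (simp add: inner_axis' del: of_nat_Suc)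
  qed
qed

lemma hessian_in_hessian_space: "(\<lambda>\<omega>. hessian (f \<omega>) y $ i $ j) \<in> hessian_space"
proof (rule completion.ae_limits_complete[OF gaussian_deriv_space])
  let ?Y = "\<lambda>n \<omega>. real (Suc n) * (gradient (f \<omega>) (y + (1 / real (Suc n)) *\<^sub>R axis j 1) $ i - gradient (f \<omega>) y $ i)"
  show "?Y n \<in> deriv_space" for n
    by (intro gaussian_space_scale[OF gaussian_deriv_space] gaussian_space_diff[OF gaussian_deriv_space] gradient_in_deriv_space)
  then show "?Y n \<in> deriv_space" for n .
  show "AE \<omega> in completion M. (\<lambda>n. ?Y n \<omega>) \<longlonglongrightarrow> hessian (f \<omega>) y $ i $ j"
    using smooth_completion
  proof eventually_elim
    fix \<omega> assume "C2_smooth (f \<omega>)"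
    from has_derivative_difference_quotients[OF C2_smooth_has_derivative(3)[OF this], of y "axis j 1" i]
    show "(\<lambda>n. ?Y n \<omega>) \<longlonglongrightarrow> hessian (f \<omega>) y $ i $ j"
      by (simp add: matrix_vector_mult_axis_component del: of_nat_Suc)
  qed
qed

lemma expectation_field_mult: "P.expectation (\<lambda>\<omega>. f \<omega> y * f \<omega> z) = covariance_kernel M f y z"
proof -
  have "(\<lambda>\<omega>. f \<omega> y) \<in> borel_measurable M" for y
    using gaussian[unfolded gaussian_field_def, rule_format, of "{y}" "\<lambda>_. 1"] by (simp add: centred_normal_def)
  then show ?thesis
    unfolding covariance_kernel_def by (intro integral_completion) simp
qed

lemma covariance_shift: "covariance_kernel M f (y + h) (z + h) = covariance_kernel M f y z"
  using stationary by (simp add: stationary_field_def)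

lemma covariance_commute: "covariance_kernel M f y z = covariance_kernel M f z y"
  by (simp add: covariance_kernel_def mult.commute)

lemma field_variance: "P.expectation (\<lambda>\<omega>. f \<omega> y * f \<omega> y) = 1"
  using stationary by (simp add: expectation_field_mult stationary_field_def)

text \<open>Combinations of field values that are symmetric, respectively antisymmetric, under the
  reflection in \<open>x\<close>. The first family contains the second-order difference
  quotients whose iterated limit is the Hessian at \<open>x\<close>, the second one the central difference quotients
  whose limit is the gradient at \<open>x\<close>.\<close>

definition even_span :: "real^'n \<Rightarrow> ('w \<Rightarrow> real) set" where
  "even_span x = {\<lambda>\<omega>. a * (f \<omega> (x + u) + f \<omega> (x - u)) + b * (f \<omega> (x + w) + f \<omega> (x - w)) | a b u w. True}"

definition odd_span :: "real^'n \<Rightarrow> ('w \<Rightarrow> real) set" where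
  "odd_span x = {\<lambda>\<omega>. a * (f \<omega> (x + v) - f \<omega> (x - v)) | a v. True}"

lemma even_span_subset: "even_span x \<subseteq> field_span"
proof -
  have "(\<lambda>\<omega>. a * (f \<omega> (x + u) + f \<omega> (x - u)) + b * (f \<omega> (x + w) + f \<omega> (x - w))) \<in> field_span" for a b u w
  proof (intro gaussian_space_lincomb[OF gaussian_field_span])
    show "(\<lambda>\<omega>. f \<omega> (x + u) + f \<omega> (x - u)) \<in> field_span" for u
      using gaussian_space_lincomb[OF gaussian_field_span field_in_span field_in_span, of 1 "x + u" 1 "x - u"] by simp
    then show "(\<lambda>\<omega>. f \<omega> (x + w) + f \<omega> (x - w)) \<in> field_span" .
  qed
  then show ?thesis by (auto simp: even_span_def)
qed

lemma odd_span_subset: "odd_span x \<subseteq> field_span"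
proof -
  have "(\<lambda>\<omega>. a * (f \<omega> (x + v) - f \<omega> (x - v))) \<in> field_span" for a v
    by (intro gaussian_space_scale[OF gaussian_field_span] gaussian_space_diff[OF gaussian_field_span] field_in_span)
  then show ?thesis by (auto simp: odd_span_def)
qed

text \<open>A stationary covariance kernel is symmetric, hence invariant under the reflection in \<open>x\<close>. This
  reflection fixes the even combinations and changes the sign of the odd ones.\<close>

lemma even_orthogonal_odd:
  assumes "X \<in> even_span x" and "Y \<in> odd_span x"
  shows "P.expectation (\<lambda>\<omega>. X \<omega> * Y \<omega>) = 0"
proof -
  let ?K = "covariance_kernel M f"
  have int: "integrable (completion M) (\<lambda>\<omega>. f \<omega> y * f \<omega> z)" for y z
    by (rule P.gaussian_space_integrable_mult[OF gaussian_field_span field_in_span field_in_span])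
  \<comment> \<open>Shift by \<open>u + v\<close> and exchange the two arguments.\<close>
  have reflect: "?K (x - u) (x - v) = ?K (x + u) (x + v)" for u v
    using covariance_shift[of "x - u" "u + v" "x - v"] covariance_commute[of "x + u" "x + v"]
    by (simp add: algebra_simps)
  from assms obtain a b u w c v where
    XY: "X = (\<lambda>\<omega>. a * (f \<omega> (x + u) + f \<omega> (x - u)) + b * (f \<omega> (x + w) + f \<omega> (x - w)))"
      "Y = (\<lambda>\<omega>. c * (f \<omega> (x + v) - f \<omega> (x - v)))"
    by (auto simp: even_span_def odd_span_def)
  have pair: "P.expectation (\<lambda>\<omega>. (f \<omega> (x + u) + f \<omega> (x - u)) * (f \<omega> (x + v) - f \<omega> (x - v))) = 0"
     "integrable (completion M) (\<lambda>\<omega>. (f \<omega> (x + u) + f \<omega> (x - u)) * (f \<omega> (x + v) - f \<omega> (x - v)))" for u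
  proof -
    have eq: "(\<lambda>\<omega>. (f \<omega> (x + u) + f \<omega> (x - u)) * (f \<omega> (x + v) - f \<omega> (x - v))) =
      (\<lambda>\<omega>. f \<omega> (x + u) * f \<omega> (x + v) - f \<omega> (x + u) * f \<omega> (x - v)
         + (f \<omega> (x - u) * f \<omega> (x + v) - f \<omega> (x - u) * f \<omega> (x - v)))"
      by (simp add: fun_eq_iff algebra_simps)
    show "integrable (completion M) (\<lambda>\<omega>. (f \<omega> (x + u) + f \<omega> (x - u)) * (f \<omega> (x + v) - f \<omega> (x - v)))"
      unfolding eq by (intro Bochner_Integration.integrable_add Bochner_Integration.integrable_diff int)
    have "P.expectation (\<lambda>\<omega>. (f \<omega> (x + u) + f \<omega> (x - u)) * (f \<omega> (x + v) - f \<omega> (x - v))) =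
       ?K (x + u) (x + v) - ?K (x + u) (x - v) + (?K (x - u) (x + v) - ?K (x - u) (x - v))"
      unfolding eq using int by (simp add: expectation_field_mult)
    also have "\<dots> = 0" using reflect[of u v] reflect[of u "-v"] by simp
    finally show "P.expectation (\<lambda>\<omega>. (f \<omega> (x + u) + f \<omega> (x - u)) * (f \<omega> (x + v) - f \<omega> (x - v))) = 0" .
  qed
  have "P.expectation (\<lambda>\<omega>. X \<omega> * Y \<omega>) = P.expectation (\<lambda>\<omega>.
      (a * c) * ((f \<omega> (x + u) + f \<omega> (x - u)) * (f \<omega> (x + v) - f \<omega> (x - v)))
    + (b * c) * ((f \<omega> (x + w) + f \<omega> (x - w)) * (f \<omega> (x + v) - f \<omega> (x - v))))"
    unfolding XY by (intro Bochner_Integration.integral_cong) (auto simp: algebra_simps)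
  also have "\<dots> = 0"
    using pair(2)[of u] pair(2)[of w] pair(1)[of u] pair(1)[of w] by simp
  finally show ?thesis .
qed

lemma gradient_in_odd: "(\<lambda>\<omega>. gradient (f \<omega>) x $ i) \<in> ae_limits (completion M) (odd_span x)"
proof (rule completion.ae_limits_complete[OF gaussian_field_span])
  let ?Y = "\<lambda>n \<omega>. real (Suc n) / 2 * (f \<omega> (x + (1 / real (Suc n)) *\<^sub>R axis i 1) - f \<omega> (x - (1 / real (Suc n)) *\<^sub>R axis i 1))"
  show Y: "?Y n \<in> odd_span x" for n
    unfolding odd_span_def by blast
  then show "?Y n \<in> field_span" for n using odd_span_subset by blast
  show "AE \<omega> in completion M. (\<lambda>n. ?Y n \<omega>) \<longlonglongrightarrow> gradient (f \<omega>) x $ i"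
    using smooth_completion
  proof eventually_elim
    fix \<omega> assume "C2_smooth (f \<omega>)"
    from has_derivative_central_difference_quotients[OF C2_smooth_has_derivative(1)[OF this], of x "axis i 1"]
    show "(\<lambda>n. ?Y n \<omega>) \<longlonglongrightarrow> gradient (f \<omega>) x $ i" by (simp add: inner_axis' del: of_nat_Suc)
  qed
qed

text \<open>Forward difference quotients at \<open>x + h\<close> are paired with backward ones at \<open>x - h\<close>, which makes the
  approximation symmetric.\<close>

lemma gradient_difference_in_even:
  "(\<lambda>\<omega>. a * (gradient (f \<omega>) (x + h) $ i - gradient (f \<omega>) (x - h) $ i)) \<in> ae_limits (completion M) (even_span x)"
proof (rule completion.ae_limits_complete[OF gaussian_field_span])
  let ?Y = "\<lambda>n \<omega>. (a * real (Suc n)) * (f \<omega> (x + (h + (1 / real (Suc n)) *\<^sub>R axis i 1)) + f \<omega> (x - (h + (1 / real (Suc n)) *\<^sub>R axis i 1)))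
     + (- a * real (Suc n)) * (f \<omega> (x + h) + f \<omega> (x - h))"
  show Y: "?Y n \<in> even_span x" for n
    unfolding even_span_def by blast
  then show "?Y n \<in> field_span" for n using even_span_subset by blast
  show "AE \<omega> in completion M. (\<lambda>n. ?Y n \<omega>) \<longlonglongrightarrow> a * (gradient (f \<omega>) (x + h) $ i - gradient (f \<omega>) (x - h) $ i)"
    using smooth_completion
  proof eventually_elim
    fix \<omega> assume C: "C2_smooth (f \<omega>)"
    have "(\<lambda>n. a * (real (Suc n) * (f \<omega> ((x + h) + (1 / real (Suc n)) *\<^sub>R axis i 1) - f \<omega> (x + h))
        - real (Suc n) * (f \<omega> (x - h) - f \<omega> ((x - h) - (1 / real (Suc n)) *\<^sub>R axis i 1))))
       \<longlonglongrightarrow> a * (axis i 1 \<bullet> gradient (f \<omega>) (x + h) - axis i 1 \<bullet> gradient (f \<omega>) (x - h))"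
      by (intro tendsto_intros has_derivative_difference_quotients has_derivative_backward_difference_quotients
          C2_smooth_has_derivative(1)[OF C])
    moreover have "?Y n \<omega> = a * (real (Suc n) * (f \<omega> ((x + h) + (1 / real (Suc n)) *\<^sub>R axis i 1) - f \<omega> (x + h))
        - real (Suc n) * (f \<omega> (x - h) - f \<omega> ((x - h) - (1 / real (Suc n)) *\<^sub>R axis i 1)))" for n
      by (simp only: add.assoc diff_diff_eq) (simp add: algebra_simps del: of_nat_Suc)
    ultimately show "(\<lambda>n. ?Y n \<omega>) \<longlonglongrightarrow> a * (gradient (f \<omega>) (x + h) $ i - gradient (f \<omega>) (x - h) $ i)"
      by (simp add: inner_axis' del: of_nat_Suc)
  qed
qed

lemma even_limits_subset: "ae_limits (completion M) (even_span x) \<subseteq> deriv_space"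
  and odd_limits_subset: "ae_limits (completion M) (odd_span x) \<subseteq> deriv_space"
  using even_span_subset[of x] odd_span_subset[of x] unfolding ae_limits_def by blast+

lemma hessian_in_even:
  "(\<lambda>\<omega>. hessian (f \<omega>) x $ i $ j) \<in> ae_limits (completion M) (ae_limits (completion M) (even_span x))"
proof (rule completion.ae_limits_complete[OF gaussian_deriv_space])
  let ?Y = "\<lambda>n \<omega>. real (Suc n) / 2 * (gradient (f \<omega>) (x + (1 / real (Suc n)) *\<^sub>R axis j 1) $ i - gradient (f \<omega>) (x - (1 / real (Suc n)) *\<^sub>R axis j 1) $ i)"
  show Y: "?Y n \<in> ae_limits (completion M) (even_span x)" for n
    by (rule gradient_difference_in_even)
  then show "?Y n \<in> deriv_space" for n using even_limits_subset by blast
  show "AE \<omega> in completion M. (\<lambda>n. ?Y n \<omega>) \<longlonglongrightarrow> hessian (f \<omega>) x $ i $ j"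
    using smooth_completion
  proof eventually_elim
    fix \<omega> assume "C2_smooth (f \<omega>)"
    from has_derivative_central_difference_quotients[OF C2_smooth_has_derivative(3)[OF this], of x "axis j 1" i]
    show "(\<lambda>n. ?Y n \<omega>) \<longlonglongrightarrow> hessian (f \<omega>) x $ i $ j"
      by (simp add: matrix_vector_mult_axis_component del: of_nat_Suc)
  qed
qed

lemma expectation_field_gradient: "P.expectation (\<lambda>\<omega>. f \<omega> x * gradient (f \<omega>) x $ i) = 0"
proof (rule P.orthogonal_ae_limits[OF gaussian_field_span even_span_subset odd_span_subset even_orthogonal_odd _ gradient_in_odd])
  have "(\<lambda>\<omega>. f \<omega> x) = (\<lambda>\<omega>. (1/2) * (f \<omega> (x + 0) + f \<omega> (x - 0)) + 0 * (f \<omega> (x + 0) + f \<omega> (x - 0)))"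
    by simp
  then have "(\<lambda>\<omega>. f \<omega> x) \<in> even_span x" unfolding even_span_def by blast
  then show "(\<lambda>\<omega>. f \<omega> x) \<in> ae_limits (completion M) (even_span x)"
    using gaussian_space_measurable[OF gaussian_field_span field_in_span]
    by (intro ae_limitsI[where Y="\<lambda>_ \<omega>. f \<omega> x"]) auto
qed

lemma expectation_hessian_gradient: "P.expectation (\<lambda>\<omega>. hessian (f \<omega>) x $ i $ j * gradient (f \<omega>) x $ k) = 0"
proof (rule P.orthogonal_ae_limits[OF gaussian_deriv_space even_limits_subset odd_limits_subset _ hessian_in_even])
  show "(\<lambda>\<omega>. gradient (f \<omega>) x $ k) \<in> ae_limits (completion M) (ae_limits (completion M) (odd_span x))"
    by (rule ae_limitsI[where Y="\<lambda>_ \<omega>. gradient (f \<omega>) x $ k", OF gaussian_space_measurable[OF gaussian_deriv_space gradient_in_deriv_space] gradient_in_odd]) simp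
  show "P.expectation (\<lambda>\<omega>. X \<omega> * Y \<omega>) = 0"
    if "X \<in> ae_limits (completion M) (even_span x)" "Y \<in> ae_limits (completion M) (odd_span x)" for X Y
    by (rule P.orthogonal_ae_limits[OF gaussian_field_span even_span_subset odd_span_subset even_orthogonal_odd that])
qed

text \<open>The product rule for \<open>E[f \<cdot> \<partial>\<^sub>i f] = 0\<close>, which holds at every point: differentiating in direction \<open>j\<close> gives
  \<open>E[\<partial>\<^sub>j f \<cdot> \<partial>\<^sub>i f] + E[f \<cdot> \<partial>\<^sub>j \<partial>\<^sub>i f] = 0\<close>. In terms of difference quotients, the discrete product rule is exact
  for every step \<open>h n\<close>.\<close>

lemma expectation_hessian_field:
  "P.expectation (\<lambda>\<omega>. hessian (f \<omega>) x $ i $ j * f \<omega> x) = - P.expectation (\<lambda>\<omega>. gradient (f \<omega>) x $ i * gradient (f \<omega>) x $ j)"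
proof -
  note S = gaussian_hessian_space
  have fS: "(\<lambda>\<omega>. f \<omega> y) \<in> hessian_space" for y
    using field_in_span field_span_subset deriv_space_subset by blast
  have gS: "(\<lambda>\<omega>. gradient (f \<omega>) y $ i) \<in> hessian_space" for y i
    using gradient_in_deriv_space deriv_space_subset by blast
  define h where "h n = (1 / real (Suc n)) *\<^sub>R (axis j 1 :: real^'n)" for n
  define D where "D n \<omega> = real (Suc n) * (f \<omega> (x + h n) - f \<omega> x)" for n \<omega>
  define Q where "Q n \<omega> = real (Suc n) * (gradient (f \<omega>) (x + h n) $ i - gradient (f \<omega>) x $ i)" for n \<omega>
  have DS: "D n \<in> hessian_space" and QS: "Q n \<in> hessian_space" for n
    unfolding D_def[abs_def] Q_def[abs_def]
    by (intro gaussian_space_scale[OF S] gaussian_space_diff[OF S] fS gS)+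
  have h0: "h \<longlonglongrightarrow> 0"
    unfolding h_def using tendsto_scaleR[OF LIMSEQ_Suc[OF lim_const_over_n[of 1]] tendsto_const, of "axis j 1 :: real^'n"] by simp
  have 1: "(\<lambda>n. P.expectation (\<lambda>\<omega>. D n \<omega> * gradient (f \<omega>) (x + h n) $ i)) \<longlonglongrightarrow>
      P.expectation (\<lambda>\<omega>. gradient (f \<omega>) x $ j * gradient (f \<omega>) x $ i)"
  proof (rule P.covariance_tendsto[OF S DS gS gS gS])
    show "AE \<omega> in completion M. (\<lambda>n. D n \<omega>) \<longlonglongrightarrow> gradient (f \<omega>) x $ j"
      using smooth_completion
    proof eventually_elim
      fix \<omega> assume "C2_smooth (f \<omega>)"
      from has_derivative_difference_quotients[OF C2_smooth_has_derivative(1)[OF this], of x "axis j 1"]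
      show "(\<lambda>n. D n \<omega>) \<longlonglongrightarrow> gradient (f \<omega>) x $ j" by (simp add: D_def h_def inner_axis' del: of_nat_Suc)
    qed
    show "AE \<omega> in completion M. (\<lambda>n. gradient (f \<omega>) (x + h n) $ i) \<longlonglongrightarrow> gradient (f \<omega>) x $ i"
      using smooth_completion
    proof eventually_elim
      fix \<omega> assume "C2_smooth (f \<omega>)"
      from has_derivative_continuous[OF C2_smooth_has_derivative(3)[OF this, of i x]]
      have "isCont (\<lambda>y. gradient (f \<omega>) y $ i) x" .
      moreover have "(\<lambda>n. x + h n) \<longlonglongrightarrow> x" using tendsto_add[OF tendsto_const h0, of x] by simp
      ultimately show "(\<lambda>n. gradient (f \<omega>) (x + h n) $ i) \<longlonglongrightarrow> gradient (f \<omega>) x $ i"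
        by (rule isCont_tendsto_compose)
    qed
  qed
  have 2: "(\<lambda>n. P.expectation (\<lambda>\<omega>. Q n \<omega> * f \<omega> x)) \<longlonglongrightarrow> P.expectation (\<lambda>\<omega>. hessian (f \<omega>) x $ i $ j * f \<omega> x)"
  proof (rule P.covariance_tendsto[OF S QS fS hessian_in_hessian_space fS])
    show "AE \<omega> in completion M. (\<lambda>n. Q n \<omega>) \<longlonglongrightarrow> hessian (f \<omega>) x $ i $ j"
      using smooth_completion
    proof eventually_elim
      fix \<omega> assume "C2_smooth (f \<omega>)"
      from has_derivative_difference_quotients[OF C2_smooth_has_derivative(3)[OF this], of x "axis j 1" i]
      show "(\<lambda>n. Q n \<omega>) \<longlonglongrightarrow> hessian (f \<omega>) x $ i $ j"
        by (simp add: Q_def h_def matrix_vector_mult_axis_component del: of_nat_Suc)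
    qed
  qed simp
  have "P.expectation (\<lambda>\<omega>. D n \<omega> * gradient (f \<omega>) (x + h n) $ i) + P.expectation (\<lambda>\<omega>. Q n \<omega> * f \<omega> x) = 0" for n
  proof -
    note mi = P.gaussian_space_integrable_mult[OF S]
    have "P.expectation (\<lambda>\<omega>. D n \<omega> * gradient (f \<omega>) (x + h n) $ i) + P.expectation (\<lambda>\<omega>. Q n \<omega> * f \<omega> x) =
      P.expectation (\<lambda>\<omega>. D n \<omega> * gradient (f \<omega>) (x + h n) $ i + Q n \<omega> * f \<omega> x)"
      by (rule Bochner_Integration.integral_add[OF mi[OF DS gS] mi[OF QS fS], symmetric])
    also have "\<dots> = P.expectation (\<lambda>\<omega>. real (Suc n) * (f \<omega> (x + h n) * gradient (f \<omega>) (x + h n) $ i) - real (Suc n) * (f \<omega> x * gradient (f \<omega>) x $ i))"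
      by (intro Bochner_Integration.integral_cong) (auto simp: D_def Q_def algebra_simps)
    also have "\<dots> = real (Suc n) * P.expectation (\<lambda>\<omega>. f \<omega> (x + h n) * gradient (f \<omega>) (x + h n) $ i)
       - real (Suc n) * P.expectation (\<lambda>\<omega>. f \<omega> x * gradient (f \<omega>) x $ i)"
      by (subst Bochner_Integration.integral_diff[OF integrable_mult_right[OF mi[OF fS gS]] integrable_mult_right[OF mi[OF fS gS]]]) simp
    finally show ?thesis by (simp add: expectation_field_gradient)
  qed
  with tendsto_add[OF 1 2] show ?thesis
    by (simp add: LIMSEQ_const_iff mult.commute)
qed

end

section \<open>The conditional expectation of the curvature\<close>

lemma continuous_AE_lborel_eq:
  fixes g h :: "real \<Rightarrow> real"
  assumes "continuous_on UNIV g" "continuous_on UNIV h" and ae: "AE z in lborel. g z = h z"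
  shows "g = h"
proof (rule ccontr)
  assume "g \<noteq> h"
  have "open {z. g z \<noteq> h z}"
    using assms(1,2) by (rule open_Collect_neq)
  moreover have "{z. g z \<noteq> h z} \<noteq> {}" using \<open>g \<noteq> h\<close> by auto
  ultimately have "\<not> negligible {z. g z \<noteq> h z}" by (rule open_not_negligible)
  moreover have "AE z in lebesgue. g z = h z" using ae by (rule AE_completion)
  then have "negligible {z. g z \<noteq> h z}"
    by (simp add: negligible_iff_null_sets completion.AE_iff_null_sets)
  ultimately show False by simp
qed

lemma distributed_AE_iff:
  assumes X: "distributed N lborel X p" and [measurable]: "Measurable.pred borel P"
  shows "(AE \<omega> in N. P (X \<omega>)) \<longleftrightarrow> (AE z in lborel. 0 < p z \<longrightarrow> P z)"
proof -
  have [measurable]: "X \<in> measurable N lborel" "p \<in> borel_measurable lborel"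
    using X unfolding distributed_def by blast+
  have "(AE \<omega> in N. P (X \<omega>)) \<longleftrightarrow> (AE z in distr N lborel X. P z)"
    by (rule AE_distr_iff[symmetric]) measurable
  also have "\<dots> \<longleftrightarrow> (AE z in lborel. 0 < p z \<longrightarrow> P z)"
    unfolding distributed_distr_eq_density[OF X] by (rule AE_density) simp
  finally show ?thesis .
qed

context prob_space begin

text \<open>A nondegenerate normal law has a positive density, so two regression functions agree almost everywhere,
  and two continuous functions that agree almost everywhere are equal.\<close>

lemma continuous_regression_unique:
  assumes X: "centred_normal M X" "\<not> (AE \<omega> in M. X \<omega> = 0)"
    and g: "continuous_regression M Y X g" and h: "continuous_regression M Y X h"
  shows "g = h"
proof -
  obtain \<sigma> where \<sigma>: "\<sigma> > 0" and D: "distributed M lborel X (normal_density 0 \<sigma>)"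
    using X by (auto simp: centred_normal_def)
  have c: "continuous_on UNIV g" "continuous_on UNIV h"
    using g h by (auto simp: continuous_regression_def)
  have [measurable]: "g \<in> borel_measurable borel" "h \<in> borel_measurable borel"
    using c by (auto intro: borel_measurable_continuous_onI)
  let ?E = "real_cond_exp M (vimage_algebra (space M) X borel) Y"
  have "AE \<omega> in M. ?E \<omega> = g (X \<omega>)" "AE \<omega> in M. ?E \<omega> = h (X \<omega>)"
    using g h by (simp_all add: continuous_regression_def)
  then have "AE \<omega> in M. g (X \<omega>) = h (X \<omega>)"
    by eventually_elim simp
  then have "AE z in lborel. 0 < ennreal (normal_density 0 \<sigma> z) \<longrightarrow> g z = h z"
    by (subst (asm) distributed_AE_iff[OF D]) auto
  then have "AE z in lborel. g z = h z"
    by eventually_elim (simp add: normal_density_pos[OF \<sigma>])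
  then show ?thesis by (rule continuous_AE_lborel_eq[OF c])
qed

lemma continuous_regressionI:
  fixes X Y :: "'a \<Rightarrow> real"
  assumes [measurable]: "X \<in> borel_measurable M" and Y: "integrable M Y"
    and g: "continuous_on UNIV g" and gX: "integrable M (\<lambda>\<omega>. g (X \<omega>))"
    and eq: "\<And>B. B \<in> sets borel \<Longrightarrow>
      expectation (\<lambda>\<omega>. indicator B (X \<omega>) * Y \<omega>) = expectation (\<lambda>\<omega>. indicator B (X \<omega>) * g (X \<omega>))"
  shows "continuous_regression M Y X g"
  unfolding continuous_regression_def
proof (intro conjI Y g)
  let ?F = "vimage_algebra (space M) X borel"
  have sets_F: "sets ?F = {X -` A \<inter> space M | A. A \<in> sets borel}"
    by (rule sets_vimage_algebra2) simp
  have "subalgebra M ?F"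
    unfolding subalgebra_def sets_F by (auto intro: measurable_sets)
  then interpret F: finite_measure_subalgebra M ?F
    by unfold_locales
  show "AE \<omega> in M. real_cond_exp M ?F Y \<omega> = g (X \<omega>)"
  proof (rule F.real_cond_exp_charact)
    fix A assume "A \<in> sets ?F"
    then obtain B where B: "B \<in> sets borel" "A = X -` B \<inter> space M" by (auto simp: sets_F)
    have "(\<integral>\<omega>\<in>A. Z \<omega> \<partial>M) = expectation (\<lambda>\<omega>. indicator B (X \<omega>) * Z \<omega>)" for Z :: "'a \<Rightarrow> real"
      unfolding set_lebesgue_integral_def B
      by (intro Bochner_Integration.integral_cong) (auto simp: indicator_def)
    then show "(\<integral>\<omega>\<in>A. Y \<omega> \<partial>M) = (\<integral>\<omega>\<in>A. g (X \<omega>) \<partial>M)"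
      using eq[OF B(1)] by simp
  next
    have "g \<in> borel_measurable borel" using g by (rule borel_measurable_continuous_onI)
    moreover have "X \<in> borel_measurable ?F" by (rule measurable_vimage_algebra1) simp
    ultimately show "(\<lambda>\<omega>. g (X \<omega>)) \<in> borel_measurable ?F" by (rule measurable_compose[rotated])
  qed (use Y gX in auto)
qed

end

text \<open>The vectors with \<open>v \<bullet> gradient = 0\<close> form a hyperplane, which a law with a density does not charge.\<close>

lemma nondegenerate_field_AE_gradient:
  fixes f :: "'w \<Rightarrow> real^'n \<Rightarrow> real"
  assumes "nondegenerate_field M f" and v: "v \<noteq> 0"
  shows "AE \<omega> in completion M. v \<bullet> gradient (f \<omega>) x \<noteq> 0"
proof -
  obtain p where p: "distributed (completion M) lborel (\<lambda>\<omega>. (f \<omega> x, gradient (f \<omega>) x)) p"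
    using assms by (auto simp: nondegenerate_field_def)
  have "negligible {z :: real \<times> (real^'n). (0, v) \<bullet> z = 0}"
    using v by (intro negligible_hyperplane) (simp add: zero_prod_def)
  then have "{z :: real \<times> (real^'n). (0, v) \<bullet> z = 0} \<in> null_sets lebesgue"
    by (simp add: negligible_iff_null_sets)
  then have "AE z in lebesgue. (0, v) \<bullet> (z :: real \<times> (real^'n)) \<noteq> 0"
    by (simp add: completion.AE_iff_null_sets)
  then have ae: "AE z in lborel. (0, v) \<bullet> (z :: real \<times> (real^'n)) \<noteq> 0"
    by (simp add: AE_completion_iff)
  have "AE \<omega> in completion M. (0, v) \<bullet> (f \<omega> x, gradient (f \<omega>) x) \<noteq> 0"
    unfolding distributed_AE_iff[OF p, of "\<lambda>z. (0, v) \<bullet> z \<noteq> 0", simplified]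
    using ae by (subst distributed_AE_iff[OF p]) auto
  then show ?thesis by simp
qed

context smooth_stationary_gaussian_field begin

lemma curvature_regression:
  assumes card: "CARD('n) \<ge> 2" and nd: "nondegenerate_field M f"
  shows "integrable (completion M) (\<lambda>\<omega>. norm (gradient (f \<omega>) x))"
    and "continuous_regression (completion M) (\<lambda>\<omega>. level_curvature (f \<omega>) x) (\<lambda>\<omega>. f \<omega> x)
          (\<lambda>a. - a * P.expectation (\<lambda>\<omega>. norm (gradient (f \<omega>) x)))"
proof -
  note S = gaussian_hessian_space
  let ?X = "\<lambda>\<omega>. f \<omega> x" and ?V = "\<lambda>\<omega>. gradient (f \<omega>) x" and ?H = "\<lambda>i j \<omega>. hessian (f \<omega>) x $ i $ j"
  let ?Y = "\<lambda>\<omega>. \<Sum>i\<in>UNIV. \<Sum>j\<in>UNIV. unit_jac i j (?V \<omega>) * ?H j i \<omega>"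
  let ?\<kappa> = "\<lambda>\<omega>. level_curvature (f \<omega>) x"
  let ?c = "P.expectation (\<lambda>\<omega>. norm (?V \<omega>))"
  have XS: "?X \<in> hessian_space"
    using field_in_span field_span_subset deriv_space_subset by blast
  have compS: "(\<lambda>\<omega>. ?V \<omega> $ i) \<in> hessian_space" for i
    using gradient_in_deriv_space deriv_space_subset by blast
  have VS: "(\<lambda>\<omega>. v \<bullet> ?V \<omega>) \<in> hessian_space" for v
    using gaussian_space_sum[OF S _ finite, of UNIV "\<lambda>i \<omega>. ?V \<omega> $ i" "\<lambda>i. v $ i"] compS
    by (auto simp: inner_vec_def)
  note reg = P.gaussian_curvature_regression[OF S XS VS hessian_in_hessian_space field_variance
      expectation_field_gradient expectation_hessian_gradient expectation_hessian_field
      nondegenerate_field_AE_gradient[OF nd] card]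
  show "integrable (completion M) (\<lambda>\<omega>. norm (?V \<omega>))"
    using reg(1)[of UNIV] by simp
  have Y_int: "integrable (completion M) ?Y" using reg(2)[of UNIV] by simp
  obtain i0 :: 'n where True by auto
  have "AE \<omega> in completion M. ?V \<omega> \<noteq> 0"
    using nondegenerate_field_AE_gradient[OF nd, of "axis i0 1" x] by (auto elim!: eventually_mono)
  then have \<kappa>_Y: "AE \<omega> in completion M. ?Y \<omega> = ?\<kappa> \<omega>"
    using smooth_completion by eventually_elim (simp add: level_curvature_eq)
  have Xm[measurable]: "?X \<in> borel_measurable (completion M)"
    by (rule gaussian_space_measurable[OF S XS])
  have Ym[measurable]: "?Y \<in> borel_measurable (completion M)"
    using Y_int by (rule borel_measurable_integrable)
  have \<kappa>m[measurable]: "?\<kappa> \<in> borel_measurable (completion M)"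
    by (rule completion.borel_measurable_AE_limit[where Y="\<lambda>_. ?Y", OF Ym]) (use \<kappa>_Y in eventually_elim, simp)
  have \<kappa>_int: "integrable (completion M) ?\<kappa>"
    using Y_int \<kappa>_Y by (subst integrable_cong_AE[of _ _ ?Y]) (auto elim!: eventually_mono)
  have X_int: "integrable (completion M) ?X"
    by (rule P.centred_normal_integrable[OF gaussian_space_centred_normal[OF S XS]])
  show "continuous_regression (completion M) ?\<kappa> ?X (\<lambda>a. - a * ?c)"
  proof (rule P.continuous_regressionI[OF Xm \<kappa>_int])
    show "continuous_on UNIV (\<lambda>a. - a * ?c)" by (intro continuous_intros)
    show "integrable (completion M) (\<lambda>\<omega>. - f \<omega> x * ?c)" using X_int by simp
    fix B :: "real set" assume B[measurable]: "B \<in> sets borel"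
    have "P.expectation (\<lambda>\<omega>. indicator B (f \<omega> x) * ?\<kappa> \<omega>) = P.expectation (\<lambda>\<omega>. indicator B (f \<omega> x) * ?Y \<omega>)"
      using \<kappa>_Y by (intro integral_cong_AE) (auto elim!: eventually_mono)
    also have "\<dots> = - ?c * P.expectation (\<lambda>\<omega>. indicator B (f \<omega> x) * f \<omega> x)"
      by (rule reg(3)[OF _ B])
    also have "\<dots> = P.expectation (\<lambda>\<omega>. - ?c * (indicator B (f \<omega> x) * f \<omega> x))"
      by simp
    also have "\<dots> = P.expectation (\<lambda>\<omega>. indicator B (f \<omega> x) * (- f \<omega> x * ?c))"
      by (intro Bochner_Integration.integral_cong) (auto simp: mult_ac)
    finally show "P.expectation (\<lambda>\<omega>. indicator B (f \<omega> x) * ?\<kappa> \<omega>) =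
      P.expectation (\<lambda>\<omega>. indicator B (f \<omega> x) * (- f \<omega> x * ?c))" .
  qed
qed

lemma field_nondegenerate_at_point: "\<not> (AE \<omega> in completion M. f \<omega> x = 0)"
  using P.gaussian_space_AE_zero[OF gaussian_field_span field_in_span[of x]] field_variance[of x]
  by (simp add: power2_eq_square)

end

theorem corollary2p4:
  fixes M :: "'w measure"
    and f :: "'w \<Rightarrow> real^'n \<Rightarrow> real"
    and x :: "real^'n"
    and a :: real
  assumes "prob_space M"
    and "CARD('n) \<ge> 2"
    and "gaussian_field M f"
    and "stationary_field M f"
    and "AE \<omega> in M. C2_smooth (f \<omega>)"
    and "nondegenerate_field M f"
    and "AE \<omega> in M. morse_function (f \<omega>)"
  shows "(\<exists>!g. continuous_regression (completion M)
                (\<lambda>\<omega>. level_curvature (f \<omega>) x) (\<lambda>\<omega>. f \<omega> x) g) \<and>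
         integrable (completion M) (\<lambda>\<omega>. norm (gradient (f \<omega>) x)) \<and>
         cond_exp_at (completion M) (\<lambda>\<omega>. level_curvature (f \<omega>) x) (\<lambda>\<omega>. f \<omega> x) a
           = - a * (\<integral>\<omega>. norm (gradient (f \<omega>) x) \<partial>completion M)"
proof -
  interpret smooth_stationary_gaussian_field M f
    using assms by (intro smooth_stationary_gaussian_field.intro)
  let ?reg = "continuous_regression (completion M) (\<lambda>\<omega>. level_curvature (f \<omega>) x) (\<lambda>\<omega>. f \<omega> x)"
  let ?g = "\<lambda>a. - a * (\<integral>\<omega>. norm (gradient (f \<omega>) x) \<partial>completion M)"
  have reg: "?reg ?g" by (rule curvature_regression(2)[OF assms(2,6)])
  have uniq: "h = ?g" if "?reg h" for h
    using gaussian_space_centred_normal[OF gaussian_field_span field_in_span] field_nondegenerate_at_point that reg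
    by (rule P.continuous_regression_unique)
  have the: "(THE g. ?reg g) = ?g"
    using reg uniq by (rule the_equality)
  have "\<exists>!g. ?reg g" using reg uniq by (rule ex1I)
  then show ?thesis
    using curvature_regression(1)[OF assms(2,6)] unfolding cond_exp_at_def the by simp
qed

end
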